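(* Let $\kappa>0$, $\theta>0$, $\gamma>0$, $-1\le\rho\le1$ and $x_0\in\mathbb{R}$. In the Sch\"obel-Zhu stochastic volatility model $$dS_t=S_tY_t\,\mathbf{1}_{t\in[0,\zeta)}\,dW^{(1)}_t,\quad S_0=1,\qquad dY_t=\kappa(\theta-Y_t)\mathbf{1}_{t\in[0,\zeta)}\,dt+\gamma\,\mathbf{1}_{t\in[0,\zeta)}\,dW_t,\quad Y_0=x_0,$$ the stock price $(S_t)_{0\le t<\infty}$ is a true $P$-martingale.
   Context: Under $P$, $W$ and $W^{(1)}$ are standard Brownian motions for a common filtration with $\mathbb{E}[dW^{(1)}_t\,dW_t]=\rho\,dt$; precisely $W^{(1)}=\rho W+\sqrt{1-\rho^2}\,W^{(2)}$ with $W^{(2)}$ a Brownian motion independent of $(Y,W)$. The process $Y$ is an Ornstein-Uhlenbeck process with state space $J=(-\infty,\infty)$, and $\zeta$ is the (possible) exit time of $Y$ from $J$ ($\zeta=\infty$ if $Y$ does not exit). Explicitly $S_t=\exp\{\int_0^{t\wedge\zeta}Y_u\,dW^{(1)}_u-\frac12\int_0^{t\wedge\zeta}Y_u^2\,du\}$. *)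

theory Defs
  imports "HOL-Probability.Probability"
begin

text \<open>
  Stochastic processes are curried functions of type \<open>real \<Rightarrow> 'a \<Rightarrow> 'b\<close>; only times \<open>t \<ge> 0\<close> matter.
  Filtrations are those of the library, indexed by \<open>real\<close>; their members at negative times play
  no role. No completeness or right-continuity of the filtration is assumed.
\<close>

definition filtered_prob_space :: "'a measure \<Rightarrow> (real \<Rightarrow> 'a measure) \<Rightarrow> bool" where
  "filtered_prob_space M F \<longleftrightarrow>
     prob_space M \<and> filtration (space M) F \<and> (\<forall>t. subalgebra M (F t))"

definition adapted :: "(real \<Rightarrow> 'a measure) \<Rightarrow> (real \<Rightarrow> 'a \<Rightarrow> 'b::topological_space) \<Rightarrow> bool" where
  "adapted F X \<longleftrightarrow> (\<forall>t\<ge>0. X t \<in> borel_measurable (F t))"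

definition continuous_paths :: "'a measure \<Rightarrow> (real \<Rightarrow> 'a \<Rightarrow> 'b::topological_space) \<Rightarrow> bool" where
  "continuous_paths M X \<longleftrightarrow> (\<forall>\<omega>\<in>space M. continuous_on {0..} (\<lambda>t. X t \<omega>))"

definition progressively_measurable ::
    "(real \<Rightarrow> 'a measure) \<Rightarrow> (real \<Rightarrow> 'a \<Rightarrow> real) \<Rightarrow> bool" where
  "progressively_measurable F H \<longleftrightarrow>
     (\<forall>T\<ge>0. (\<lambda>(t, \<omega>). H t \<omega>) \<in> borel_measurable (restrict_space borel {0..T} \<Otimes>\<^sub>M F T))"

definition martingale ::
    "'a measure \<Rightarrow> (real \<Rightarrow> 'a measure) \<Rightarrow> (real \<Rightarrow> 'a \<Rightarrow> real) \<Rightarrow> bool" where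
  "martingale M F X \<longleftrightarrow>
     adapted F X \<and> (\<forall>t\<ge>0. integrable M (X t)) \<and>
     (\<forall>s t. 0 \<le> s \<longrightarrow> s \<le> t \<longrightarrow> (AE \<omega> in M. real_cond_exp M (F s) (X t) \<omega> = X s \<omega>))"

definition generated_sigma ::
    "'a measure \<Rightarrow> real set \<Rightarrow> (real \<Rightarrow> 'a \<Rightarrow> 'b::topological_space) \<Rightarrow> 'a measure" where
  "generated_sigma M I X =
     sigma (space M) (\<Union>t\<in>I. {X t -` A \<inter> space M | A. A \<in> sets borel})"

definition brownian_motion ::
    "'a measure \<Rightarrow> (real \<Rightarrow> 'a measure) \<Rightarrow> (real \<Rightarrow> 'a \<Rightarrow> real) \<Rightarrow> bool" where
  "brownian_motion M F B \<longleftrightarrow>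
     adapted F B \<and> continuous_paths M B \<and> (AE \<omega> in M. B 0 \<omega> = 0) \<and>
     (\<forall>s t. 0 \<le> s \<longrightarrow> s < t \<longrightarrow>
        distributed M lborel (\<lambda>\<omega>. B t \<omega> - B s \<omega>) (normal_density 0 (sqrt (t - s))) \<and>
        prob_space.indep_set M (sets (F s))
          {(\<lambda>\<omega>. B t \<omega> - B s \<omega>) -` A \<inter> space M | A. A \<in> sets borel})"

definition tends_to_0_in_probability :: "'a measure \<Rightarrow> (nat \<Rightarrow> 'a \<Rightarrow> ennreal) \<Rightarrow> bool" where
  "tends_to_0_in_probability M Z \<longleftrightarrow>
     (\<forall>\<epsilon>>0. (\<lambda>n. measure M {\<omega> \<in> space M. ennreal \<epsilon> \<le> Z n \<omega>}) \<longlonglongrightarrow> 0)"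

text \<open>
  Simple integrands \<open>\<Sum>i<N. \<xi>\<^sub>i 1\<^bsub>(\<tau>\<^sub>i, \<tau>\<^sub>i\<^sub>+\<^sub>1]\<^esub>\<close> on a deterministic grid, with \<open>\<xi>\<^sub>i\<close> bounded and
  measurable with respect to \<open>F (\<tau>\<^sub>i)\<close>, and their elementary integrals.
\<close>

definition simple_integrand ::
    "'a measure \<Rightarrow> (real \<Rightarrow> 'a measure) \<Rightarrow> nat \<Rightarrow> (nat \<Rightarrow> real) \<Rightarrow> (nat \<Rightarrow> 'a \<Rightarrow> real) \<Rightarrow> bool" where
  "simple_integrand M F N \<tau> \<xi> \<longleftrightarrow>
     0 \<le> \<tau> 0 \<and> (\<forall>i<N. \<tau> i \<le> \<tau> (Suc i)) \<and>
     (\<forall>i<N. \<xi> i \<in> borel_measurable (F (\<tau> i)) \<and> (\<exists>c. \<forall>\<omega>\<in>space M. \<bar>\<xi> i \<omega>\<bar> \<le> c))"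

definition simple_process ::
    "nat \<Rightarrow> (nat \<Rightarrow> real) \<Rightarrow> (nat \<Rightarrow> 'a \<Rightarrow> real) \<Rightarrow> real \<Rightarrow> 'a \<Rightarrow> real" where
  "simple_process N \<tau> \<xi> t \<omega> = (\<Sum>i<N. \<xi> i \<omega> * indicator {\<tau> i<..\<tau> (Suc i)} t)"

definition simple_integral ::
    "nat \<Rightarrow> (nat \<Rightarrow> real) \<Rightarrow> (nat \<Rightarrow> 'a \<Rightarrow> real) \<Rightarrow> (real \<Rightarrow> 'a \<Rightarrow> real) \<Rightarrow> real \<Rightarrow> 'a \<Rightarrow> real" where
  "simple_integral N \<tau> \<xi> B t \<omega> =
     (\<Sum>i<N. \<xi> i \<omega> * (B (min t (\<tau> (Suc i))) \<omega> - B (min t (\<tau> i)) \<omega>))"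

text \<open>
  \<open>ito_integral M F B H I\<close> says that \<open>I\<close> is (a continuous version of) the Ito integral process
  \<open>I\<^sub>t = \<integral>\<^sub>0\<^sup>t H\<^sub>u dB\<^sub>u\<close> of the progressively measurable, almost surely locally square-integrable
  process \<open>H\<close> with respect to the \<open>F\<close>-Brownian motion \<open>B\<close>. As usual, it is the limit, locally
  uniformly in time in probability, of elementary integrals of simple integrands that converge
  to \<open>H\<close> in \<open>L\<^sup>2([0,T])\<close> in probability. It is a relation because the integral is only determined
  up to indistinguishability.
\<close>

definition ito_integral ::
    "'a measure \<Rightarrow> (real \<Rightarrow> 'a measure) \<Rightarrow> (real \<Rightarrow> 'a \<Rightarrow> real) \<Rightarrow>
     (real \<Rightarrow> 'a \<Rightarrow> real) \<Rightarrow> (real \<Rightarrow> 'a \<Rightarrow> real) \<Rightarrow> bool" where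
  "ito_integral M F B H I \<longleftrightarrow>
     progressively_measurable F H \<and>
     (AE \<omega> in M. \<forall>T\<ge>0. (\<integral>\<^sup>+ t\<in>{0..T}. ennreal ((H t \<omega>)\<^sup>2) \<partial>lborel) < \<infinity>) \<and>
     adapted F I \<and> continuous_paths M I \<and>
     (\<exists>N \<tau> \<xi>. (\<forall>n. simple_integrand M F (N n) (\<tau> n) (\<xi> n)) \<and>
        (\<forall>T\<ge>0.
           tends_to_0_in_probability M (\<lambda>n \<omega>.
             \<integral>\<^sup>+ t\<in>{0..T}. ennreal ((simple_process (N n) (\<tau> n) (\<xi> n) t \<omega> - H t \<omega>)\<^sup>2) \<partial>lborel) \<and>
           tends_to_0_in_probability M (\<lambda>n \<omega>.
             SUP t\<in>{0..T}. ennreal \<bar>simple_integral (N n) (\<tau> n) (\<xi> n) B t \<omega> - I t \<omega>\<bar>)))"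

definition exit_time :: "(real \<Rightarrow> 'a \<Rightarrow> 'b) \<Rightarrow> 'b set \<Rightarrow> 'a \<Rightarrow> ereal" where
  "exit_time Y J \<omega> = Inf (ereal ` {t. 0 \<le> t \<and> Y t \<omega> \<notin> J})"

definition before :: "('a \<Rightarrow> ereal) \<Rightarrow> real \<Rightarrow> 'a \<Rightarrow> real" where
  "before \<zeta> t \<omega> = indicator {0..<\<zeta> \<omega>} (ereal t)"

text \<open>
  The two equations of the Schoebel-Zhu model. The variance factor \<open>Y\<close> takes values in the
  extended reals, so that exit from the state space \<open>J = (-\<infinity>, \<infinity>)\<close> is explosion; from
  \<open>\<zeta>\<close> on it stays where it left \<open>J\<close>. Its stochastic differential equation is an identity between
  real numbers strictly before \<open>\<zeta>\<close> (the integrand of the stochastic integral is bounded, so the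
  integral itself is defined for all times).
\<close>

definition sz_variance ::
    "'a measure \<Rightarrow> (real \<Rightarrow> 'a measure) \<Rightarrow> (real \<Rightarrow> 'a \<Rightarrow> real) \<Rightarrow> real \<Rightarrow> real \<Rightarrow> real \<Rightarrow> real \<Rightarrow>
     (real \<Rightarrow> 'a \<Rightarrow> ereal) \<Rightarrow> ('a \<Rightarrow> ereal) \<Rightarrow> bool" where
  "sz_variance M F W \<kappa> \<theta> \<gamma> x\<^sub>0 Y \<zeta> \<longleftrightarrow>
     adapted F Y \<and> continuous_paths M Y \<and>
     \<zeta> = exit_time Y {-\<infinity><..<\<infinity>} \<and>
     (AE \<omega> in M. Y 0 \<omega> = ereal x\<^sub>0) \<and>
     (\<forall>\<omega>\<in>space M. \<forall>t\<ge>0. \<zeta> \<omega> \<le> ereal t \<longrightarrow> Y t \<omega> = Y (real_of_ereal (\<zeta> \<omega>)) \<omega>) \<and>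
     (\<exists>I. ito_integral M F W (\<lambda>t \<omega>. \<gamma> * before \<zeta> t \<omega>) I \<and>
        (AE \<omega> in M. \<forall>t\<ge>0. ereal t < \<zeta> \<omega> \<longrightarrow>
           Y t \<omega> = ereal (x\<^sub>0 +
             (LBINT u:{0..t}. \<kappa> * (\<theta> - real_of_ereal (Y u \<omega>)) * before \<zeta> u \<omega>) + I t \<omega>)))"

text \<open>
  The stock price is the solution of \<open>dS\<^sub>t = S\<^sub>t Y\<^sub>t 1\<^bsub>t < \<zeta>\<^esub> dW\<^sup>(\<^sup>1\<^sup>)\<^sub>t\<close>, \<open>S\<^sub>0 = 1\<close>, given explicitly by
  the stochastic exponential; the integrals over \<open>[0, t \<and> \<zeta>]\<close> are written with the integrand
  \<open>Y\<^sub>u 1\<^bsub>u < \<zeta>\<^esub>\<close> over \<open>[0, t]\<close>.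
\<close>

definition sz_stock_price ::
    "'a measure \<Rightarrow> (real \<Rightarrow> 'a measure) \<Rightarrow> (real \<Rightarrow> 'a \<Rightarrow> real) \<Rightarrow>
     (real \<Rightarrow> 'a \<Rightarrow> ereal) \<Rightarrow> ('a \<Rightarrow> ereal) \<Rightarrow> (real \<Rightarrow> 'a \<Rightarrow> real) \<Rightarrow> bool" where
  "sz_stock_price M F W1 Y \<zeta> S \<longleftrightarrow>
     adapted F S \<and> continuous_paths M S \<and>
     (\<exists>I. ito_integral M F W1 (\<lambda>t \<omega>. S t \<omega> * real_of_ereal (Y t \<omega>) * before \<zeta> t \<omega>) I \<and>
        (AE \<omega> in M. \<forall>t\<ge>0. S t \<omega> = 1 + I t \<omega>)) \<and>
     (\<exists>X. ito_integral M F W1 (\<lambda>t \<omega>. real_of_ereal (Y t \<omega>) * before \<zeta> t \<omega>) X \<and>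
        (AE \<omega> in M. \<forall>t\<ge>0. S t \<omega> =
           exp (X t \<omega> - 1/2 * (LBINT u:{0..t}. (real_of_ereal (Y u \<omega>) * before \<zeta> u \<omega>)\<^sup>2))))"

end

theory Submission
  imports Defs
begin

text \<open>
  Write \<open>R = S\<^sub>t / S\<^sub>s\<close>. The stochastic exponentials of simple integrands are exact martingales, by
  independence of the Brownian increments. Approximate the integral over \<open>[s, t]\<close> by such simple
  integrals \<open>J\<close>, each switched off before its quadratic variation \<open>V\<close> exceeds a level \<open>K\<close>. AM-GM gives
  \<open>exp (2 J - V) \<le> exp (4 J - 8 V) + exp (6 V)\<close>, where the first term has expectation 1, so the
  approximations are bounded in \<open>L\<^sup>2\<close> as soon as \<open>E exp (6 \<integral>\<^sub>s\<^sup>t Y\<^sub>u\<^sup>2 du)\<close> is finite; letting \<open>K\<close> grow gives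
  \<open>E (R | F\<^sub>s) = 1\<close>.

  That exponential moment is finite for \<open>t - s\<close> small: pathwise
  \<open>\<bar>Y\<^sub>u\<bar> \<le> C + \<bar>I\<^sub>u\<bar> + \<kappa> \<integral>\<^sub>0\<^sup>T \<bar>I\<^sub>v\<bar> dv\<close> before \<open>\<zeta>\<close>, where \<open>I\<close> is the noise integral, and \<open>I\<close> is
  subgaussian by the same exponential identity, its integrand being bounded by \<open>\<gamma>\<close>. The result for
  arbitrary \<open>s \<le> t\<close> follows by chaining short intervals.
\<close>

section \<open>Exponential martingales on a deterministic grid\<close>

text \<open>The obstacle is that \<open>Y\<close> has tails of Gaussian type, so exponential moments
  of its integrated square are available only for small constants, and a Novikov condition over a
  long interval may fail. On a short window the length of the window supplies the small factor; the
  admissible length depends on the horizon only, so finitely many windows suffice. The argument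
  rests directly on the definition of \<open>ito_integral\<close> as a limit of elementary
  integrals. Almost sure convergence of these says nothing about exponential moments of their
  variations; this is what forces the cap, and the cap level and the index of the approximation have
  to be chosen together. Non-explosion of \<open>Y\<close> is never proved: the integrand carries
  the indicator of times before \<zeta>, so a bound valid before \<zeta> is a bound at all
  times.\<close>

lemma nn_integral_normal_density_exp:
  assumes "0 < v"
  shows "(\<integral>\<^sup>+x. ennreal (normal_density 0 (sqrt v) x) * ennreal (exp (a * x - a\<^sup>2 * v / 2)) \<partial>lborel) = 1"
proof -
  have "normal_density 0 (sqrt v) x * exp (a * x - a\<^sup>2 * v / 2) = normal_density (a * v) (sqrt v) x" for x
  proof -
    have "- x\<^sup>2 / (2 * v) + (a * x - a\<^sup>2 * v / 2) = - (x - a * v)\<^sup>2 / (2 * v)"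
      using assms by (simp add: field_simps power2_eq_square)
    then show ?thesis
      using assms by (simp add: normal_density_def mult_exp_exp)
  qed
  then have "(\<integral>\<^sup>+x. ennreal (normal_density 0 (sqrt v) x) * ennreal (exp (a * x - a\<^sup>2 * v / 2)) \<partial>lborel)
      = (\<integral>\<^sup>+x. ennreal (normal_density (a * v) (sqrt v) x) \<partial>lborel)"
    by (simp add: ennreal_mult'[symmetric])
  also have "\<dots> = ennreal (\<integral>x. normal_density (a * v) (sqrt v) x \<partial>lborel)"
    using assms by (intro nn_integral_eq_integral integrable_normal_density) auto
  also have "\<dots> = 1"
    using assms by (subst integral_normal_density) auto
  finally show ?thesis .
qed

text \<open>Independence says on rectangles that the joint law of the identity map into
  \<open>G\<close> and of \<open>D\<close> is a product; Tonelli then integrates \<open>D\<close>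
  out with the \<open>G\<close>-measurable argument frozen.\<close>

lemma (in prob_space) nn_integral_indep_subalgebra:
  assumes G: "subalgebra M G" and D: "D \<in> borel_measurable M"
    and indep: "indep_set (sets G) {D -` A \<inter> space M | A. A \<in> sets (borel :: real measure)}"
    and f: "f \<in> borel_measurable (G \<Otimes>\<^sub>M borel)"
  shows "(\<integral>\<^sup>+\<omega>. f (\<omega>, D \<omega>) \<partial>M) = (\<integral>\<^sup>+\<omega>. (\<integral>\<^sup>+x. f (\<omega>, x) \<partial>distr M borel D) \<partial>M)"
proof -
  note D[measurable] f[measurable]
  have id[measurable]: "(\<lambda>\<omega>. \<omega>) \<in> measurable M G"
    using G by (auto simp: subalgebra_def measurable_def)
  have spG: "space G = space M"
    using G by (simp add: subalgebra_def)
  interpret D: prob_space "distr M borel D"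
    by (intro prob_space_distr D)
  interpret G: prob_space "distr M G (\<lambda>\<omega>. \<omega>)"
    by (intro prob_space_distr id)
  have eq: "distr M G (\<lambda>\<omega>. \<omega>) \<Otimes>\<^sub>M distr M borel D = distr M (G \<Otimes>\<^sub>M borel) (\<lambda>\<omega>. (\<omega>, D \<omega>))"
  proof (rule pair_measure_eqI[OF G.sigma_finite_measure_axioms D.sigma_finite_measure_axioms])
    fix A :: "'a set" and B :: "real set"
    assume "A \<in> sets (distr M G (\<lambda>\<omega>. \<omega>))" and "B \<in> sets (distr M borel D)"
    then have AB[measurable]: "A \<in> sets G" "B \<in> sets borel" by auto
    then have "A \<subseteq> space M" using sets.sets_into_space[of A G] spG by simp
    have "prob (A \<inter> (D -` B \<inter> space M)) = prob A * prob (D -` B \<inter> space M)"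
      using AB by (intro indep_setD[OF indep]) auto
    moreover have "(\<lambda>\<omega>. (\<omega>, D \<omega>)) -` (A \<times> B) \<inter> space M = A \<inter> (D -` B \<inter> space M)"
      using \<open>A \<subseteq> space M\<close> by auto
    moreover have "(\<lambda>\<omega>. \<omega>) -` A \<inter> space M = A"
      using \<open>A \<subseteq> space M\<close> by auto
    ultimately show "emeasure (distr M G (\<lambda>\<omega>. \<omega>)) A * emeasure (distr M borel D) B
        = emeasure (distr M (G \<Otimes>\<^sub>M borel) (\<lambda>\<omega>. (\<omega>, D \<omega>))) (A \<times> B)"
      by (simp add: emeasure_distr emeasure_eq_measure ennreal_mult')
  qed (simp cong: sets_pair_measure_cong)
  have "(\<integral>\<^sup>+\<omega>. f (\<omega>, D \<omega>) \<partial>M) = (\<integral>\<^sup>+z. f z \<partial>distr M (G \<Otimes>\<^sub>M borel) (\<lambda>\<omega>. (\<omega>, D \<omega>)))"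
    by (subst nn_integral_distr) auto
  also have "\<dots> = (\<integral>\<^sup>+\<omega>. (\<integral>\<^sup>+x. f (\<omega>, x) \<partial>distr M borel D) \<partial>distr M G (\<lambda>\<omega>. \<omega>))"
    unfolding eq[symmetric] by (subst D.nn_integral_fst[symmetric]) (auto simp: eq)
  also have "\<dots> = (\<integral>\<^sup>+\<omega>. (\<integral>\<^sup>+x. f (\<omega>, x) \<partial>distr M borel D) \<partial>M)"
    by (subst nn_integral_distr) auto
  finally show ?thesis .
qed

text \<open>With \<xi> frozen, the inner integral is the normalised Gaussian moment generating
  function, which is 1 for every value of \<xi>; hence \<xi> may be unbounded.\<close>

lemma (in prob_space) nn_integral_indep_normal_exp:
  assumes G: "subalgebra M G" and D: "distributed M lborel D (normal_density 0 (sqrt v))" and "0 < v"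
    and indep: "indep_set (sets G) {D -` A \<inter> space M | A. A \<in> sets (borel :: real measure)}"
    and X[measurable]: "X \<in> borel_measurable G" and \<xi>[measurable]: "\<xi> \<in> borel_measurable G"
  shows "(\<integral>\<^sup>+\<omega>. X \<omega> * ennreal (exp (\<xi> \<omega> * D \<omega> - (\<xi> \<omega>)\<^sup>2 * v / 2)) \<partial>M) = (\<integral>\<^sup>+\<omega>. X \<omega> \<partial>M)"
proof -
  have D'[measurable]: "D \<in> borel_measurable M"
    using distributed_measurable[OF D] by simp
  have distr: "distr M borel D = density lborel (normal_density 0 (sqrt v))"
    using distributed_distr_eq_density[OF D]
    by (metis distr_cong sets_lborel)
  let ?f = "\<lambda>(\<omega>, x). X \<omega> * ennreal (exp (\<xi> \<omega> * x - (\<xi> \<omega>)\<^sup>2 * v / 2))"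
  have "(\<integral>\<^sup>+\<omega>. X \<omega> * ennreal (exp (\<xi> \<omega> * D \<omega> - (\<xi> \<omega>)\<^sup>2 * v / 2)) \<partial>M) = (\<integral>\<^sup>+\<omega>. ?f (\<omega>, D \<omega>) \<partial>M)"
    by simp
  also have "\<dots> = (\<integral>\<^sup>+\<omega>. (\<integral>\<^sup>+x. ?f (\<omega>, x) \<partial>distr M borel D) \<partial>M)"
    by (rule nn_integral_indep_subalgebra[OF G D' indep]) measurable
  also have "\<dots> = (\<integral>\<^sup>+\<omega>. X \<omega> \<partial>M)"
    unfolding distr
    by (intro nn_integral_cong)
       (simp add: nn_integral_density nn_integral_cmult mult.left_commute[of _ "X _"]
          nn_integral_normal_density_exp[OF \<open>0 < v\<close>])
  finally show ?thesis .
qed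

lemma brownian_motionD:
  assumes "brownian_motion M F B"
  shows brownian_motion_adapted: "adapted F B"
    and brownian_motion_continuous: "continuous_paths M B"
    and brownian_motion_increment: "0 \<le> s \<Longrightarrow> s < t \<Longrightarrow>
      distributed M lborel (\<lambda>\<omega>. B t \<omega> - B s \<omega>) (normal_density 0 (sqrt (t - s)))"
    and brownian_motion_indep: "0 \<le> s \<Longrightarrow> s < t \<Longrightarrow>
      prob_space.indep_set M (sets (F s)) {(\<lambda>\<omega>. B t \<omega> - B s \<omega>) -` A \<inter> space M | A. A \<in> sets borel}"
  using assms by (auto simp: brownian_motion_def)

lemma filtered_prob_spaceD:
  assumes "filtered_prob_space M F"
  shows filtered_prob_space_prob_space: "prob_space M"
    and filtered_prob_space_subalgebra: "subalgebra M (F t)"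
    and filtered_prob_space_mono: "s \<le> t \<Longrightarrow> subalgebra (F t) (F s)"
  using assms by (auto simp: filtered_prob_space_def subalgebra_def filtration_def)

lemma filtered_measurable_mono:
  assumes "filtered_prob_space M F" "s \<le> t" "f \<in> measurable (F s) N"
  shows "f \<in> measurable (F t) N"
  using measurable_from_subalg[OF filtered_prob_space_mono[OF assms(1,2)] assms(3)] .

lemma filtered_measurable_M:
  assumes "filtered_prob_space M F" "f \<in> measurable (F s) N"
  shows "f \<in> measurable M N"
  using measurable_from_subalg[OF filtered_prob_space_subalgebra[OF assms(1)] assms(2)] .

text \<open>The coefficients are not assumed bounded, unlike in \<open>simple_integrand\<close>: the
  exponential identity concerns nonnegative integrals, so no integrability has to be secured. The
  lower bound \<open>s\<close> on the grid makes events of \<open>F s\<close> known at every grid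
  point.\<close>

definition grid_integrand :: "(real \<Rightarrow> 'a measure) \<Rightarrow> real \<Rightarrow> nat \<Rightarrow> (nat \<Rightarrow> real) \<Rightarrow> (nat \<Rightarrow> 'a \<Rightarrow> real) \<Rightarrow> bool" where
  "grid_integrand F s N \<sigma> \<xi> \<longleftrightarrow>
     s \<le> \<sigma> 0 \<and> (\<forall>i<N. \<sigma> i \<le> \<sigma> (Suc i)) \<and> (\<forall>i<N. \<xi> i \<in> borel_measurable (F (\<sigma> i)))"

definition grid_integral :: "nat \<Rightarrow> (nat \<Rightarrow> real) \<Rightarrow> (nat \<Rightarrow> 'a \<Rightarrow> real) \<Rightarrow> (real \<Rightarrow> 'a \<Rightarrow> real) \<Rightarrow> 'a \<Rightarrow> real" where
  "grid_integral N \<sigma> \<xi> B \<omega> = (\<Sum>i<N. \<xi> i \<omega> * (B (\<sigma> (Suc i)) \<omega> - B (\<sigma> i) \<omega>))"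

definition grid_variation :: "nat \<Rightarrow> (nat \<Rightarrow> real) \<Rightarrow> (nat \<Rightarrow> 'a \<Rightarrow> real) \<Rightarrow> 'a \<Rightarrow> real" where
  "grid_variation N \<sigma> \<xi> \<omega> = (\<Sum>i<N. (\<xi> i \<omega>)\<^sup>2 * (\<sigma> (Suc i) - \<sigma> i))"

lemma Suc_mono_upto:
  fixes f :: "nat \<Rightarrow> 'a::order"
  assumes step: "\<And>i. i < N \<Longrightarrow> f i \<le> f (Suc i)" and "i \<le> j" "j \<le> N"
  shows "f i \<le> f j"
  using assms(2,3)
proof (induction j)
  case (Suc j)
  show ?case
  proof (cases "i = Suc j")
    case False
    with Suc.prems have "f i \<le> f j" "f j \<le> f (Suc j)"
      by (auto intro!: Suc.IH step)
    then show ?thesis by (rule order_trans)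
  qed simp
qed simp

lemma grid_le:
  assumes "grid_integrand F s N \<sigma> \<xi>" "i \<le> j" "j \<le> N"
  shows "\<sigma> i \<le> \<sigma> j"
  using assms(1) by (intro Suc_mono_upto[OF _ assms(2,3), where f=\<sigma>]) (simp add: grid_integrand_def)

lemma grid_ge:
  assumes "grid_integrand F s N \<sigma> \<xi>" "i \<le> N"
  shows "s \<le> \<sigma> i"
  using grid_le[OF assms(1) _ assms(2), of 0] assms(1) by (simp add: grid_integrand_def)

lemma grid_integrand_Suc:
  "grid_integrand F s (Suc N) \<sigma> \<xi> \<Longrightarrow> grid_integrand F s N \<sigma> \<xi>"
  by (simp add: grid_integrand_def)

lemma measurable_grid_integral:
  assumes F: "filtered_prob_space M F" and B: "adapted F B" and g: "grid_integrand F s N \<sigma> \<xi>" and "0 \<le> s"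
  shows "grid_integral N \<sigma> \<xi> B \<in> borel_measurable (F (\<sigma> N))"
proof -
  have "\<xi> i \<in> borel_measurable (F (\<sigma> N))" if "i < N" for i
    using filtered_measurable_mono[OF F grid_le[OF g, of i N]] that g by (auto simp: grid_integrand_def)
  moreover have "B (\<sigma> i) \<in> borel_measurable (F (\<sigma> N))" if "i \<le> N" for i
  proof (rule filtered_measurable_mono[OF F grid_le[OF g that order_refl]])
    show "B (\<sigma> i) \<in> borel_measurable (F (\<sigma> i))"
      using B grid_ge[OF g that] \<open>0 \<le> s\<close> by (auto simp: adapted_def)
  qed
  ultimately show ?thesis
    unfolding grid_integral_def[abs_def]
    by (intro borel_measurable_sum borel_measurable_times borel_measurable_diff) auto
qed

lemma measurable_grid_variation:
  assumes F: "filtered_prob_space M F" and g: "grid_integrand F s N \<sigma> \<xi>"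
  shows "grid_variation N \<sigma> \<xi> \<in> borel_measurable (F (\<sigma> N))"
proof -
  have "\<xi> i \<in> borel_measurable (F (\<sigma> N))" if "i < N" for i
    using filtered_measurable_mono[OF F grid_le[OF g, of i N]] that g by (auto simp: grid_integrand_def)
  then show ?thesis
    unfolding grid_variation_def[abs_def]
    by (intro borel_measurable_sum borel_measurable_times borel_measurable_power) auto
qed

text \<open>Given the past up to the last but one grid point, the last factor integrates to 1 and
  can be peeled off. Carrying the event \<open>A\<close> along amounts to conditioning on
  \<open>F s\<close>.\<close>

lemma nn_integral_grid_exp:
  assumes F: "filtered_prob_space M F" and B: "brownian_motion M F B"
    and g: "grid_integrand F s N \<sigma> \<xi>" and "0 \<le> s" and A: "A \<in> sets (F s)"
  shows "(\<integral>\<^sup>+\<omega>. indicator A \<omega> * ennreal (exp (grid_integral N \<sigma> \<xi> B \<omega> - grid_variation N \<sigma> \<xi> \<omega> / 2)) \<partial>M)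
    = emeasure M A"
  using g
proof (induction N)
  case 0
  have "A \<in> sets M"
    using filtered_prob_space_subalgebra[OF F, of s] A by (auto simp: subalgebra_def)
  then show ?case by (simp add: grid_integral_def grid_variation_def)
next
  case (Suc N)
  interpret prob_space M by (rule filtered_prob_space_prob_space[OF F])
  note g = grid_integrand_Suc[OF Suc.prems]
  let ?Z = "\<lambda>N \<omega>. indicator A \<omega> * ennreal (exp (grid_integral N \<sigma> \<xi> B \<omega> - grid_variation N \<sigma> \<xi> \<omega> / 2))"
  have IH: "(\<integral>\<^sup>+\<omega>. ?Z N \<omega> \<partial>M) = emeasure M A"
    by (rule Suc.IH[OF g])
  have le: "\<sigma> N \<le> \<sigma> (Suc N)" and \<xi>: "\<xi> N \<in> borel_measurable (F (\<sigma> N))"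
    using Suc.prems by (auto simp: grid_integrand_def)
  show ?case
  \<comment> \<open>An interval of length 0 contributes the factor 1. It is split off because the
    normal law of an increment is given only for strictly increasing times.\<close>
  proof (cases "\<sigma> N = \<sigma> (Suc N)")
    case True
    then show ?thesis using IH by (simp add: grid_integral_def grid_variation_def)
  next
    case False
    define D where "D \<omega> = B (\<sigma> (Suc N)) \<omega> - B (\<sigma> N) \<omega>" for \<omega>
    define v where "v = \<sigma> (Suc N) - \<sigma> N"
    have lt: "0 \<le> \<sigma> N" "\<sigma> N < \<sigma> (Suc N)"
      using le False grid_ge[OF g, of N] \<open>0 \<le> s\<close> by auto
    have "A \<in> sets (F (\<sigma> N))"
      using A filtered_prob_space_mono[OF F grid_ge[OF g order_refl]] by (auto simp: subalgebra_def)
    then have Z: "?Z N \<in> borel_measurable (F (\<sigma> N))"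
      using measurable_grid_integral[OF F brownian_motion_adapted[OF B] g \<open>0 \<le> s\<close>]
        measurable_grid_variation[OF F g] by measurable
    have "?Z (Suc N) \<omega> = ?Z N \<omega> * ennreal (exp (\<xi> N \<omega> * D \<omega> - (\<xi> N \<omega>)\<^sup>2 * v / 2))" for \<omega>
    proof -
      have "grid_integral (Suc N) \<sigma> \<xi> B \<omega> - grid_variation (Suc N) \<sigma> \<xi> \<omega> / 2 =
        (grid_integral N \<sigma> \<xi> B \<omega> - grid_variation N \<sigma> \<xi> \<omega> / 2) + (\<xi> N \<omega> * D \<omega> - (\<xi> N \<omega>)\<^sup>2 * v / 2)"
        by (simp add: grid_integral_def grid_variation_def D_def v_def field_simps)
      then show ?thesis
        by (simp add: exp_add ennreal_mult' mult.assoc)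
    qed
    then have "(\<integral>\<^sup>+\<omega>. ?Z (Suc N) \<omega> \<partial>M) = (\<integral>\<^sup>+\<omega>. ?Z N \<omega> * ennreal (exp (\<xi> N \<omega> * D \<omega> - (\<xi> N \<omega>)\<^sup>2 * v / 2)) \<partial>M)"
      by simp
    also have "\<dots> = (\<integral>\<^sup>+\<omega>. ?Z N \<omega> \<partial>M)"
    proof (rule nn_integral_indep_normal_exp[OF filtered_prob_space_subalgebra[OF F]])
      show "distributed M lborel D (\<lambda>x. ennreal (normal_density 0 (sqrt v) x))"
        using brownian_motion_increment[OF B lt] by (simp add: D_def[abs_def] v_def)
      show "indep_set (sets (F (\<sigma> N))) {D -` A \<inter> space M | A. A \<in> sets borel}"
        using brownian_motion_indep[OF B lt] by (simp add: D_def[abs_def])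
    qed (use Z \<xi> lt in \<open>auto simp: v_def\<close>)
    finally show ?thesis using IH by simp
  qed
qed

section \<open>Passage to the limit under an exponential moment condition\<close>

text \<open>Boundedness in L^2 gives uniform integrability. Fatou bounds the limit from below; from
  above, \<open>f \<le> min f R + f\<^sup>2 / R\<close> leaves a bounded part for dominated
  convergence and an error of at most \<open>C / R\<close>, uniformly in \<open>n\<close>.\<close>

lemma (in finite_measure) nn_integral_limit_L2_bounded:
  fixes f :: "nat \<Rightarrow> 'a \<Rightarrow> real"
  assumes f[measurable]: "\<And>n. f n \<in> borel_measurable M" and nonneg: "\<And>n \<omega>. 0 \<le> f n \<omega>"
    and g[measurable]: "g \<in> borel_measurable M"
    and lim: "AE \<omega> in M. (\<lambda>n. f n \<omega>) \<longlonglongrightarrow> g \<omega>"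
    and C: "\<And>n. (\<integral>\<^sup>+\<omega>. ennreal ((f n \<omega>)\<^sup>2) \<partial>M) \<le> C" "C < \<infinity>"
  shows "(\<lambda>n. \<integral>\<^sup>+\<omega>. ennreal (f n \<omega>) \<partial>M) \<longlonglongrightarrow> (\<integral>\<^sup>+\<omega>. ennreal (g \<omega>) \<partial>M)"
proof -
  let ?a = "\<lambda>n. \<integral>\<^sup>+\<omega>. ennreal (f n \<omega>) \<partial>M" and ?b = "\<integral>\<^sup>+\<omega>. ennreal (g \<omega>) \<partial>M"
  have "?b = (\<integral>\<^sup>+\<omega>. liminf (\<lambda>n. ennreal (f n \<omega>)) \<partial>M)"
  proof (rule nn_integral_cong_AE)
    show "AE \<omega> in M. ennreal (g \<omega>) = liminf (\<lambda>n. ennreal (f n \<omega>))"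
      using lim
    proof eventually_elim
      case (elim \<omega>)
      then have "(\<lambda>n. ennreal (f n \<omega>)) \<longlonglongrightarrow> ennreal (g \<omega>)" by (rule tendsto_ennrealI)
      from lim_imp_Liminf[OF _ this] show ?case by simp
    qed
  qed
  also have "\<dots> \<le> liminf ?a" by (rule nn_integral_liminf) simp
  finally have lower: "?b \<le> liminf ?a" .
  have upper: "limsup ?a \<le> ?b + C * ennreal (1 / real (Suc R))" for R
  proof -
    let ?R = "real (Suc R)"
    have split: "ennreal (f n \<omega>) \<le> ennreal (min (f n \<omega>) ?R) + ennreal ((f n \<omega>)\<^sup>2) * ennreal (1 / ?R)" for n \<omega>
    proof -
      have "f n \<omega> \<le> min (f n \<omega>) ?R + (f n \<omega>)\<^sup>2 * (1 / ?R)"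
      proof (cases "f n \<omega> \<le> ?R")
        case False
        then have "?R * f n \<omega> \<le> (f n \<omega>)\<^sup>2"
          by (simp add: power2_eq_square mult_right_mono)
        then have "f n \<omega> \<le> (f n \<omega>)\<^sup>2 * (1 / ?R)" by (simp add: field_simps)
        moreover have "0 \<le> min (f n \<omega>) ?R" using nonneg by simp
        ultimately show ?thesis by linarith
      qed simp
      then show ?thesis
        using nonneg by (auto simp: ennreal_plus[symmetric] ennreal_mult[symmetric] simp del: ennreal_plus intro!: ennreal_leI)
    qed
    have "?a n \<le> (\<integral>\<^sup>+\<omega>. ennreal (min (f n \<omega>) ?R) \<partial>M) + C * ennreal (1 / ?R)" for n
    proof -
      have "?a n \<le> (\<integral>\<^sup>+\<omega>. ennreal (min (f n \<omega>) ?R) + ennreal ((f n \<omega>)\<^sup>2) * ennreal (1 / ?R) \<partial>M)"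
        by (intro nn_integral_mono split)
      also have "\<dots> = (\<integral>\<^sup>+\<omega>. ennreal (min (f n \<omega>) ?R) \<partial>M) + (\<integral>\<^sup>+\<omega>. ennreal ((f n \<omega>)\<^sup>2) \<partial>M) * ennreal (1 / ?R)"
        by (subst nn_integral_add) (auto simp: nn_integral_multc)
      also have "\<dots> \<le> (\<integral>\<^sup>+\<omega>. ennreal (min (f n \<omega>) ?R) \<partial>M) + C * ennreal (1 / ?R)"
        by (intro add_left_mono mult_right_mono C) simp
      finally show ?thesis .
    qed
    then have "limsup ?a \<le> limsup (\<lambda>n. (\<integral>\<^sup>+\<omega>. ennreal (min (f n \<omega>) ?R) \<partial>M) + C * ennreal (1 / ?R))"
      by (intro Limsup_mono always_eventually allI)
    also have "\<dots> = (\<integral>\<^sup>+\<omega>. ennreal (min (g \<omega>) ?R) \<partial>M) + C * ennreal (1 / ?R)"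
    proof (intro lim_imp_Limsup tendsto_add tendsto_const nn_integral_dominated_convergence[where w="\<lambda>_. ennreal ?R"])
      show "AE \<omega> in M. (\<lambda>n. ennreal (min (f n \<omega>) ?R)) \<longlonglongrightarrow> ennreal (min (g \<omega>) ?R)"
        using lim by eventually_elim (intro tendsto_ennrealI tendsto_min tendsto_const)
      show "(\<integral>\<^sup>+\<omega>. ennreal ?R \<partial>M) < \<infinity>"
        unfolding nn_integral_const infinity_ennreal_def ennreal_mult_less_top
        using finite_emeasure_space top.not_eq_extremum[of "emeasure M (space M)"] by auto
    qed (auto intro!: AE_I2 ennreal_leI simp del: of_nat_Suc)
    also have "\<dots> \<le> ?b + C * ennreal (1 / ?R)"
      by (intro add_right_mono nn_integral_mono ennreal_leI) simp
    finally show ?thesis .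
  qed
  have "(\<lambda>R. ?b + C * ennreal (1 / real (Suc R))) \<longlonglongrightarrow> ?b + C * ennreal 0"
    using C(2) by (intro tendsto_add tendsto_const tendsto_mult_ennreal tendsto_ennrealI
        LIMSEQ_Suc[OF lim_1_over_n]) auto
  then have "limsup ?a \<le> ?b + C * ennreal 0"
    by (rule LIMSEQ_le_const) (use upper in auto)
  then show ?thesis
    using lower Liminf_le_Limsup[of sequentially ?a]
    by (intro Liminf_eq_Limsup) (auto intro: antisym order_trans)
qed

text \<open>
  The sum compared with \<open>K\<close> includes the variation of the coming interval, which is already known at
  its left end point; so the capped integrand is adapted and its variation never exceeds \<open>K\<close>.
\<close>

definition cap_integrand :: "real \<Rightarrow> (nat \<Rightarrow> real) \<Rightarrow> (nat \<Rightarrow> 'a \<Rightarrow> real) \<Rightarrow> nat \<Rightarrow> 'a \<Rightarrow> real" where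
  "cap_integrand K \<sigma> \<xi> i \<omega> = (if grid_variation (Suc i) \<sigma> \<xi> \<omega> \<le> K then \<xi> i \<omega> else 0)"

lemma grid_integrand_le:
  "grid_integrand F s N \<sigma> \<xi> \<Longrightarrow> n \<le> N \<Longrightarrow> grid_integrand F s n \<sigma> \<xi>"
  by (simp add: grid_integrand_def)

lemma grid_integrand_cap:
  assumes F: "filtered_prob_space M F" and g: "grid_integrand F s N \<sigma> \<xi>"
  shows "grid_integrand F s N \<sigma> (cap_integrand K \<sigma> \<xi>)"
proof -
  have "cap_integrand K \<sigma> \<xi> i \<in> borel_measurable (F (\<sigma> i))" if "i < N" for i
  proof -
    have [measurable]: "\<xi> i \<in> borel_measurable (F (\<sigma> i))"
      using g that by (simp add: grid_integrand_def)
    have [measurable]: "grid_variation i \<sigma> \<xi> \<in> borel_measurable (F (\<sigma> i))"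
      using that by (intro measurable_grid_variation[OF F grid_integrand_le[OF g]]) simp
    have "grid_variation (Suc i) \<sigma> \<xi> = (\<lambda>\<omega>. grid_variation i \<sigma> \<xi> \<omega> + (\<xi> i \<omega>)\<^sup>2 * (\<sigma> (Suc i) - \<sigma> i))"
      by (simp add: grid_variation_def fun_eq_iff)
    then show ?thesis
      unfolding cap_integrand_def[abs_def] by simp
  qed
  then show ?thesis
    using g by (simp add: grid_integrand_def)
qed

lemma grid_variation_mono:
  assumes "grid_integrand F s N \<sigma> \<xi>" "n \<le> N"
  shows "grid_variation n \<sigma> \<xi> \<omega> \<le> grid_variation N \<sigma> \<xi> \<omega>"
  using assms unfolding grid_variation_def by (intro sum_mono2) (auto simp: grid_integrand_def)

text \<open>Capping only removes terms, which gives the bound by the uncapped variation. For the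
  bound by \<open>K\<close>: either the whole uncapped sum is at most \<open>K\<close>, or the last
  coefficient is 0 and the induction hypothesis applies.\<close>

lemma grid_variation_cap_le:
  assumes "grid_integrand F s N \<sigma> \<xi>" "0 \<le> K"
  shows "grid_variation N \<sigma> (cap_integrand K \<sigma> \<xi>) \<omega> \<le> min K (grid_variation N \<sigma> \<xi> \<omega>)"
proof -
  have le: "grid_variation n \<sigma> (cap_integrand K \<sigma> \<xi>) \<omega> \<le> grid_variation n \<sigma> \<xi> \<omega>" if "n \<le> N" for n
    using assms(1) that unfolding grid_variation_def
    by (intro sum_mono) (auto simp: cap_integrand_def grid_integrand_def)
  have "grid_variation N \<sigma> (cap_integrand K \<sigma> \<xi>) \<omega> \<le> K"
    using assms(1) le
  proof (induction N)
    case 0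
    then show ?case using assms(2) by (simp add: grid_variation_def)
  next
    case (Suc N)
    show ?case
    proof (cases "grid_variation (Suc N) \<sigma> \<xi> \<omega> \<le> K")
      case True
      with Suc.prems(2)[of "Suc N"] show ?thesis by simp
    next
      case False
      then have "grid_variation (Suc N) \<sigma> (cap_integrand K \<sigma> \<xi>) \<omega> = grid_variation N \<sigma> (cap_integrand K \<sigma> \<xi>) \<omega>"
        by (simp add: grid_variation_def[of "Suc N" \<sigma> "cap_integrand K \<sigma> \<xi>"]
            grid_variation_def[of N \<sigma> "cap_integrand K \<sigma> \<xi>"] cap_integrand_def[of K \<sigma> \<xi> N])
      then show ?thesis
        using Suc.IH[OF grid_integrand_Suc[OF Suc.prems(1)]] Suc.prems(2) by simp
    qed
  qed
  with le[of N] show ?thesis by simp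
qed

lemma cap_integrand_eq:
  assumes g: "grid_integrand F s N \<sigma> \<xi>" and K: "grid_variation N \<sigma> \<xi> \<omega> \<le> K"
  shows "grid_integral N \<sigma> (cap_integrand K \<sigma> \<xi>) B \<omega> = grid_integral N \<sigma> \<xi> B \<omega>"
    and "grid_variation N \<sigma> (cap_integrand K \<sigma> \<xi>) \<omega> = grid_variation N \<sigma> \<xi> \<omega>"
proof -
  have "cap_integrand K \<sigma> \<xi> i \<omega> = \<xi> i \<omega>" if "i < N" for i
    using grid_variation_mono[OF g, of "Suc i" \<omega>] K that by (simp add: cap_integrand_def)
  then show "grid_integral N \<sigma> (cap_integrand K \<sigma> \<xi>) B \<omega> = grid_integral N \<sigma> \<xi> B \<omega>"
    and "grid_variation N \<sigma> (cap_integrand K \<sigma> \<xi>) \<omega> = grid_variation N \<sigma> \<xi> \<omega>"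
    by (simp_all add: grid_integral_def grid_variation_def)
qed

lemma grid_scale:
  shows "grid_integral N \<sigma> (\<lambda>i \<omega>. a * \<xi> i \<omega>) B \<omega> = a * grid_integral N \<sigma> \<xi> B \<omega>"
    and "grid_variation N \<sigma> (\<lambda>i \<omega>. a * \<xi> i \<omega>) \<omega> = a\<^sup>2 * grid_variation N \<sigma> \<xi> \<omega>"
    and "grid_integrand F s N \<sigma> \<xi> \<Longrightarrow> grid_integrand F s N \<sigma> (\<lambda>i \<omega>. a * \<xi> i \<omega>)"
  by (auto simp: grid_integral_def grid_variation_def grid_integrand_def sum_distrib_left
      power_mult_distrib mult.assoc)

lemma nn_integral_grid_exp_square:
  assumes F: "filtered_prob_space M F" and B: "brownian_motion M F B"
    and g: "grid_integrand F s N \<sigma> \<xi>" and "0 \<le> s"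
    and C: "(\<integral>\<^sup>+\<omega>. ennreal (exp (6 * grid_variation N \<sigma> \<xi> \<omega>)) \<partial>M) \<le> C"
  shows "(\<integral>\<^sup>+\<omega>. ennreal ((exp (grid_integral N \<sigma> \<xi> B \<omega> - grid_variation N \<sigma> \<xi> \<omega> / 2))\<^sup>2) \<partial>M) \<le> 1 + C"
proof -
  interpret prob_space M by (rule filtered_prob_space_prob_space[OF F])
  let ?J = "grid_integral N \<sigma> \<xi> B" and ?V = "grid_variation N \<sigma> \<xi>"
  have [measurable]: "?J \<in> borel_measurable M" "?V \<in> borel_measurable M"
    using filtered_measurable_M[OF F] measurable_grid_integral[OF F brownian_motion_adapted[OF B] g \<open>0 \<le> s\<close>]
      measurable_grid_variation[OF F g] by blast+
  have sp: "space M \<in> sets (F s)"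
    using filtered_prob_space_subalgebra[OF F, of s] sets.top[of "F s"] by (simp add: subalgebra_def)
  have "ennreal ((exp (?J \<omega> - ?V \<omega> / 2))\<^sup>2) \<le> ennreal (exp (4 * ?J \<omega> - 8 * ?V \<omega>)) + ennreal (exp (6 * ?V \<omega>))" for \<omega>
  proof -
    \<comment> \<open>The split \<open>2 J - V = (2 J - 4 V) + 3 V\<close> is chosen so that
      \<open>a\<^sup>2\<close> is again a stochastic exponential: scaling the integrand by 4
      produces the compensator \<open>4\<^sup>2 V / 2 = 8 V\<close>. The remainder
      \<open>b\<^sup>2\<close> has exponent \<open>6 V\<close>, the origin of the 6 in all later
      moment conditions.\<close>
    define a b where "a = exp (2 * ?J \<omega> - 4 * ?V \<omega>)" and "b = exp (3 * ?V \<omega>)"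
    have "(exp (?J \<omega> - ?V \<omega> / 2))\<^sup>2 = a * b"
      unfolding a_def b_def by (simp add: exp_double[symmetric] mult_exp_exp algebra_simps)
    moreover have "a\<^sup>2 = exp (4 * ?J \<omega> - 8 * ?V \<omega>)" "b\<^sup>2 = exp (6 * ?V \<omega>)"
      unfolding a_def b_def by (simp_all add: exp_double[symmetric] algebra_simps)
    moreover have "2 * (a * b) \<le> a\<^sup>2 + b\<^sup>2" "0 \<le> a * b"
      using sum_squares_bound[of a b] by (simp_all add: a_def b_def)
    ultimately show ?thesis
      by (simp add: ennreal_plus[symmetric] ennreal_leI del: ennreal_plus)
  qed
  then have "(\<integral>\<^sup>+\<omega>. ennreal ((exp (?J \<omega> - ?V \<omega> / 2))\<^sup>2) \<partial>M)
      \<le> (\<integral>\<^sup>+\<omega>. ennreal (exp (4 * ?J \<omega> - 8 * ?V \<omega>)) + ennreal (exp (6 * ?V \<omega>)) \<partial>M)"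
    by (intro nn_integral_mono)
  also have "\<dots> = (\<integral>\<^sup>+\<omega>. ennreal (exp (4 * ?J \<omega> - 8 * ?V \<omega>)) \<partial>M) + (\<integral>\<^sup>+\<omega>. ennreal (exp (6 * ?V \<omega>)) \<partial>M)"
    by (intro nn_integral_add) auto
  also have "(\<integral>\<^sup>+\<omega>. ennreal (exp (4 * ?J \<omega> - 8 * ?V \<omega>)) \<partial>M) = 1"
  proof -
    have "(\<integral>\<^sup>+\<omega>. ennreal (exp (4 * ?J \<omega> - 8 * ?V \<omega>)) \<partial>M)
        = (\<integral>\<^sup>+\<omega>. indicator (space M) \<omega> * ennreal (exp (4 * ?J \<omega> - 4\<^sup>2 * ?V \<omega> / 2)) \<partial>M)"
      by (intro nn_integral_cong) simp
    also have "\<dots> = emeasure M (space M)"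
      using nn_integral_grid_exp[OF F B grid_scale(3)[OF g] \<open>0 \<le> s\<close> sp, of 4]
      unfolding grid_scale(1,2) .
    finally show ?thesis by (simp add: emeasure_space_1)
  qed
  finally show ?thesis using C by (meson add_left_mono order_trans)
qed

text \<open>Convergence of the variations does not bound their exponential moments, so the L^2 bound
  cannot be applied to the given sequence. At a fixed cap level the moments do converge, to a limit
  at most that of \<open>V\<close>; a diagonal choice of level and index then gives a sequence
  bounded in L^2 with the same limit.\<close>

lemma nn_integral_exp_limit:
  assumes F: "filtered_prob_space M F" and B: "brownian_motion M F B" and "0 \<le> s" and A: "A \<in> sets (F s)"
    and g: "\<And>n. grid_integrand F s (N n) (\<sigma> n) (\<xi> n)"
    and J[measurable]: "J \<in> borel_measurable M" and V[measurable]: "V \<in> borel_measurable M"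
    and J_lim: "AE \<omega> in M. (\<lambda>n. grid_integral (N n) (\<sigma> n) (\<xi> n) B \<omega>) \<longlonglongrightarrow> J \<omega>"
    and V_lim: "AE \<omega> in M. (\<lambda>n. grid_variation (N n) (\<sigma> n) (\<xi> n) \<omega>) \<longlonglongrightarrow> V \<omega>"
    and fin: "(\<integral>\<^sup>+\<omega>. ennreal (exp (6 * V \<omega>)) \<partial>M) < \<infinity>"
  shows "(\<integral>\<^sup>+\<omega>. indicator A \<omega> * ennreal (exp (J \<omega> - V \<omega> / 2)) \<partial>M) = emeasure M A"
proof -
  interpret prob_space M by (rule filtered_prob_space_prob_space[OF F])
  have A'[measurable]: "A \<in> sets M"
    using filtered_prob_space_subalgebra[OF F, of s] A by (auto simp: subalgebra_def)
  define C where "C = (\<integral>\<^sup>+\<omega>. ennreal (exp (6 * V \<omega>)) \<partial>M)"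
  \<comment> \<open>Finiteness of \<open>C\<close> enters here: the strict inequality turns a limit
    of at most \<open>C\<close> into a bound by \<open>C + 1\<close> at some index.\<close>
  have "C < C + 1"
  proof -
    obtain r where "C = ennreal r" "0 \<le> r"
      using fin unfolding C_def[symmetric] by (cases C) auto
    then show ?thesis
      by (simp add: ennreal_less_iff flip: ennreal_1 ennreal_plus)
  qed
  let ?J = "\<lambda>n. grid_integral (N n) (\<sigma> n) (\<xi> n) B" and ?V = "\<lambda>n. grid_variation (N n) (\<sigma> n) (\<xi> n)"
  have [measurable]: "?V n \<in> borel_measurable M" for n
    using filtered_measurable_M[OF F measurable_grid_variation[OF F g]] .
  have "\<exists>n\<ge>K. (\<integral>\<^sup>+\<omega>. ennreal (exp (6 * min (real K) (?V n \<omega>))) \<partial>M) < C + 1" for K :: nat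
  proof -
    have "(\<lambda>n. \<integral>\<^sup>+\<omega>. ennreal (exp (6 * min (real K) (?V n \<omega>))) \<partial>M)
        \<longlonglongrightarrow> (\<integral>\<^sup>+\<omega>. ennreal (exp (6 * min (real K) (V \<omega>))) \<partial>M)"
    proof (intro nn_integral_dominated_convergence[where w="\<lambda>_. ennreal (exp (6 * real K))"])
      show "AE \<omega> in M. (\<lambda>n. ennreal (exp (6 * min (real K) (?V n \<omega>))))
          \<longlonglongrightarrow> ennreal (exp (6 * min (real K) (V \<omega>)))"
        using V_lim by eventually_elim (intro tendsto_intros tendsto_ennrealI)
    qed (auto intro!: AE_I2 ennreal_leI simp: emeasure_space_1)
    moreover have "(\<integral>\<^sup>+\<omega>. ennreal (exp (6 * min (real K) (V \<omega>))) \<partial>M) \<le> C"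
      unfolding C_def by (intro nn_integral_mono ennreal_leI) simp
    then have "(\<integral>\<^sup>+\<omega>. ennreal (exp (6 * min (real K) (V \<omega>))) \<partial>M) < C + 1"
      using \<open>C < C + 1\<close> by (rule le_less_trans)
    ultimately have "eventually (\<lambda>n. (\<integral>\<^sup>+\<omega>. ennreal (exp (6 * min (real K) (?V n \<omega>))) \<partial>M) < C + 1) sequentially"
      by (rule order_tendstoD)
    then show ?thesis
      unfolding eventually_sequentially by (metis (no_types, lifting) max.cobounded1 max.cobounded2)
  qed
  then obtain n where n: "\<And>K. K \<le> n K"
    and nC: "\<And>K. (\<integral>\<^sup>+\<omega>. ennreal (exp (6 * min (real K) (?V (n K) \<omega>))) \<partial>M) < C + 1"
    by metis
  \<comment> \<open>The index \<open>n K\<close> grows with the level so that almost every path is eventually uncapped.\<close>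
  define \<eta> where "\<eta> K = cap_integrand (real K) (\<sigma> (n K)) (\<xi> (n K))" for K
  define X where "X K = grid_integral (N (n K)) (\<sigma> (n K)) (\<eta> K) B" for K
  define U where "U K = grid_variation (N (n K)) (\<sigma> (n K)) (\<eta> K)" for K
  have \<eta>: "grid_integrand F s (N (n K)) (\<sigma> (n K)) (\<eta> K)" for K
    unfolding \<eta>_def by (rule grid_integrand_cap[OF F g])
  have [measurable]: "X K \<in> borel_measurable M" "U K \<in> borel_measurable M" for K
    unfolding X_def U_def
    using filtered_measurable_M[OF F] measurable_grid_integral[OF F brownian_motion_adapted[OF B] \<eta> \<open>0 \<le> s\<close>]
      measurable_grid_variation[OF F \<eta>] by blast+
  have UC: "(\<integral>\<^sup>+\<omega>. ennreal (exp (6 * U K \<omega>)) \<partial>M) \<le> C + 1" for K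
  proof -
    have "(\<integral>\<^sup>+\<omega>. ennreal (exp (6 * U K \<omega>)) \<partial>M) \<le> (\<integral>\<^sup>+\<omega>. ennreal (exp (6 * min (real K) (?V (n K) \<omega>))) \<partial>M)"
      using grid_variation_cap_le[OF g, of "real K" "n K"]
      by (intro nn_integral_mono ennreal_leI) (simp add: U_def \<eta>_def)
    with nC[of K] show ?thesis by simp
  qed
  let ?Z = "\<lambda>K \<omega>. indicator A \<omega> * exp (X K \<omega> - U K \<omega> / 2)"
  have "(\<lambda>K. \<integral>\<^sup>+\<omega>. ennreal (?Z K \<omega>) \<partial>M) \<longlonglongrightarrow> (\<integral>\<^sup>+\<omega>. ennreal (indicator A \<omega> * exp (J \<omega> - V \<omega> / 2)) \<partial>M)"
  proof (rule nn_integral_limit_L2_bounded)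
    show "AE \<omega> in M. (\<lambda>K. ?Z K \<omega>) \<longlonglongrightarrow> indicator A \<omega> * exp (J \<omega> - V \<omega> / 2)"
      using J_lim V_lim
    proof eventually_elim
      case (elim \<omega>)
      have n_lim: "filterlim n at_top sequentially"
        by (rule filterlim_at_top_mono[OF filterlim_ident]) (simp add: n)
      have "eventually (\<lambda>K. ?V (n K) \<omega> < V \<omega> + 1) sequentially"
        using filterlim_compose[OF elim(2) n_lim] by (rule order_tendstoD) simp
      moreover have "eventually (\<lambda>K. V \<omega> + 1 \<le> real K) sequentially"
        using filterlim_real_sequentially unfolding filterlim_at_top by blast
      ultimately have "eventually (\<lambda>K. ?V (n K) \<omega> \<le> real K) sequentially"
        by eventually_elim simp
      then have "eventually (\<lambda>K. indicator A \<omega> * exp (?J (n K) \<omega> - ?V (n K) \<omega> / 2) = ?Z K \<omega>) sequentially"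
        by eventually_elim (simp add: X_def U_def \<eta>_def cap_integrand_eq[OF g])
      moreover have "(\<lambda>K. indicator A \<omega> * exp (?J (n K) \<omega> - ?V (n K) \<omega> / 2)) \<longlonglongrightarrow> indicator A \<omega> * exp (J \<omega> - V \<omega> / 2)"
        by (intro tendsto_intros filterlim_compose[OF elim(1) n_lim] filterlim_compose[OF elim(2) n_lim])
           auto
      ultimately show ?case
        by (rule Lim_transform_eventually[rotated])
    qed
    show "(\<integral>\<^sup>+\<omega>. ennreal ((?Z K \<omega>)\<^sup>2) \<partial>M) \<le> 1 + (C + 1)" for K
    proof -
      have "(\<integral>\<^sup>+\<omega>. ennreal ((?Z K \<omega>)\<^sup>2) \<partial>M) \<le> (\<integral>\<^sup>+\<omega>. ennreal ((exp (X K \<omega> - U K \<omega> / 2))\<^sup>2) \<partial>M)"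
        by (intro nn_integral_mono ennreal_leI) (simp split: split_indicator)
      also have "\<dots> \<le> 1 + (C + 1)"
        unfolding X_def U_def using UC[unfolded U_def]
        by (rule nn_integral_grid_exp_square[OF F B \<eta> \<open>0 \<le> s\<close>])
      finally show ?thesis .
    qed
    show "1 + (C + 1) < \<infinity>" using fin by (simp add: C_def)
  qed (auto simp: C_def)
  moreover have "ennreal (indicator A \<omega> * x) = indicator A \<omega> * ennreal x" for \<omega> x
    by (simp split: split_indicator)
  moreover have "(\<integral>\<^sup>+\<omega>. indicator A \<omega> * ennreal (exp (X K \<omega> - U K \<omega> / 2)) \<partial>M) = emeasure M A" for K
    unfolding X_def U_def by (rule nn_integral_grid_exp[OF F B \<eta> \<open>0 \<le> s\<close> A])
  ultimately show ?thesis
    by (simp add: LIMSEQ_const_iff)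
qed

section \<open>Almost sure approximation of Ito integrals\<close>

text \<open>By continuity the supremum may be taken over a countable dense set of times. Only a
  finite supremum needs an argument: the inequality then passes to the closure.\<close>

lemma borel_measurable_SUP_continuous:
  fixes f :: "real \<Rightarrow> 'a \<Rightarrow> real"
  assumes f: "\<And>t. t \<in> {0..T} \<Longrightarrow> f t \<in> borel_measurable M"
    and cont: "\<And>\<omega>. \<omega> \<in> space M \<Longrightarrow> continuous_on {0..T} (\<lambda>t. f t \<omega>)"
  shows "(\<lambda>\<omega>. SUP t\<in>{0..T}. ennreal \<bar>f t \<omega>\<bar>) \<in> borel_measurable M"
proof -
  obtain D where D: "countable D" "D \<subseteq> {0..T}" "{0..T} \<subseteq> closure D"
    using separable[of "{0..T}"] by auto
  have cD: "closure D = {0..T}"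
    using D closure_minimal[of D "{0..T}"] by auto
  have eq: "(SUP t\<in>{0..T}. ennreal \<bar>f t \<omega>\<bar>) = (SUP t\<in>D. ennreal \<bar>f t \<omega>\<bar>)" if \<omega>: "\<omega> \<in> space M" for \<omega>
  proof (rule antisym[OF SUP_least SUP_subset_mono])
    fix t assume t: "t \<in> {0..T}"
    show "ennreal \<bar>f t \<omega>\<bar> \<le> (SUP t\<in>D. ennreal \<bar>f t \<omega>\<bar>)"
    proof (cases "(SUP t\<in>D. ennreal \<bar>f t \<omega>\<bar>)")
      case (real r)
      have "\<bar>f t \<omega>\<bar> \<le> r"
      proof (rule continuous_le_on_closure[of D "\<lambda>t. \<bar>f t \<omega>\<bar>"])
        show "continuous_on (closure D) (\<lambda>t. \<bar>f t \<omega>\<bar>)"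
          unfolding cD by (intro continuous_intros cont \<omega>)
        show "t \<in> closure D" using t cD by simp
        show "\<bar>f u \<omega>\<bar> \<le> r" if "u \<in> D" for u
        proof -
          have "ennreal \<bar>f u \<omega>\<bar> \<le> ennreal r"
            unfolding real(2)[symmetric] using that by (rule SUP_upper)
          then show ?thesis using real(1) by simp
        qed
      qed
      then show ?thesis unfolding real(2) by (rule ennreal_leI)
    next
      case top
      show ?thesis unfolding top by (rule top_greatest)
    qed
  qed (use D in auto)
  have "(\<lambda>\<omega>. SUP t\<in>D. ennreal \<bar>f t \<omega>\<bar>) \<in> borel_measurable M"
    using D f by (intro borel_measurable_SUP) (auto intro!: measurable_compose[OF borel_measurable_abs measurable_ennreal])
  then show ?thesis
    using eq by (subst measurable_cong) auto
qed

text \<open>Progressive measurability concerns \<open>[0, T]\<close> and \<open>F T\<close> only.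
  The indicator extends the process by 0 to all times, which makes Fubini over \<open>borel\<close>
  and \<open>M\<close> applicable.\<close>

lemma progressively_measurable_joint:
  assumes F: "filtered_prob_space M F" and H: "progressively_measurable F H" and "0 \<le> T"
  shows "(\<lambda>(t, \<omega>). indicator {0..T} t * H t \<omega>) \<in> borel_measurable (borel \<Otimes>\<^sub>M M)"
proof -
  let ?R = "restrict_space (borel \<Otimes>\<^sub>M M) ({0..T} \<times> space M)"
  have sets: "({0..T} \<times> space M) \<inter> space (borel \<Otimes>\<^sub>M M) \<in> sets (borel \<Otimes>\<^sub>M M)"
    by (intro sets.Int pair_measureI) auto
  have "(\<lambda>(t, \<omega>). H t \<omega>) \<in> borel_measurable (restrict_space borel {0..T} \<Otimes>\<^sub>M F T)"
    using H \<open>0 \<le> T\<close> by (simp add: progressively_measurable_def)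
  moreover have "(\<lambda>x. (fst x, snd x)) \<in> measurable ?R (restrict_space borel {0..T} \<Otimes>\<^sub>M F T)"
  proof (rule measurable_Pair)
    show "fst \<in> measurable ?R (restrict_space borel {0..T})"
      by (intro measurable_restrict_space2 measurable_restrict_space1 measurable_fst)
         (auto simp: space_restrict_space)
    show "snd \<in> measurable ?R (F T)"
    proof (intro measurable_restrict_space1 measurable_compose[OF measurable_snd])
      show "(\<lambda>\<omega>. \<omega>) \<in> measurable M (F T)"
        using filtered_prob_space_subalgebra[OF F, of T] by (auto simp: subalgebra_def measurable_def)
    qed
  qed
  ultimately have "(\<lambda>x. case (fst x, snd x) of (t, \<omega>) \<Rightarrow> H t \<omega>) \<in> borel_measurable ?R"
    by (rule measurable_compose[rotated])
  then have "(\<lambda>x. indicator ({0..T} \<times> space M) x *\<^sub>R H (fst x) (snd x)) \<in> borel_measurable (borel \<Otimes>\<^sub>M M)"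
    using borel_measurable_restrict_space_iff[OF sets, of "\<lambda>x. H (fst x) (snd x)"]
    unfolding case_prod_beta fst_conv snd_conv by blast
  then show ?thesis
    by (rule measurable_cong[THEN iffD1, rotated])
       (auto simp: space_pair_measure indicator_def)
qed

text \<open>Borel-Cantelli: the probabilities are summable, so almost surely \<open>Z n\<close> is
  eventually below \<open>(1/2) ^ n\<close>.\<close>

lemma (in prob_space) AE_tendsto_0_fast:
  fixes Z :: "nat \<Rightarrow> 'a \<Rightarrow> ennreal"
  assumes Z[measurable]: "\<And>n. Z n \<in> borel_measurable M"
    and small: "\<And>n. prob {\<omega> \<in> space M. ennreal ((1/2) ^ n) \<le> Z n \<omega>} < (1/2) ^ n"
  shows "AE \<omega> in M. (\<lambda>n. Z n \<omega>) \<longlonglongrightarrow> 0"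
proof -
  let ?A = "\<lambda>n. {\<omega> \<in> space M. ennreal ((1/2) ^ n) \<le> Z n \<omega>}"
  have "AE \<omega> in M. eventually (\<lambda>n. \<omega> \<in> space M - ?A n) sequentially"
  proof (rule borel_cantelli_AE1)
    show "summable (\<lambda>n. prob (?A n))"
    proof (rule summable_comparison_test)
      show "\<exists>N. \<forall>n\<ge>N. norm (prob (?A n)) \<le> (1/2) ^ n"
        using less_imp_le[OF small] by simp
    qed (simp add: summable_geometric)
    show "emeasure M (?A n) < \<infinity>" for n
      using emeasure_finite top.not_eq_extremum unfolding infinity_ennreal_def by blast
  qed measurable
  then show ?thesis
  proof eventually_elim
    case (elim \<omega>)
    have "(\<lambda>n. ennreal ((1/2) ^ n)) \<longlonglongrightarrow> ennreal 0"
      by (intro tendsto_ennrealI LIMSEQ_power_zero) simp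
    then have lim: "(\<lambda>n. ennreal ((1/2) ^ n)) \<longlonglongrightarrow> 0" by simp
    show ?case
    proof (rule tendsto_sandwich[OF _ _ tendsto_const lim])
      show "eventually (\<lambda>n. Z n \<omega> \<le> ennreal ((1/2) ^ n)) sequentially"
        using elim by eventually_elim auto
    qed simp
  qed
qed

text \<open>One index sequence must serve both, since integrands and integrals have to converge
  along the same approximation. \<open>r\<close> need not increase: \<open>AE_tendsto_0_fast\<close>
  asks only for the bound at each index.\<close>

lemma (in prob_space) tends_to_0_in_probability_AE_subseq:
  fixes Z Z' :: "nat \<Rightarrow> 'a \<Rightarrow> ennreal"
  assumes meas: "\<And>n. Z n \<in> borel_measurable M" "\<And>n. Z' n \<in> borel_measurable M"
    and lim: "tends_to_0_in_probability M Z" "tends_to_0_in_probability M Z'"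
  obtains r :: "nat \<Rightarrow> nat"
  where "AE \<omega> in M. (\<lambda>n. Z (r n) \<omega>) \<longlonglongrightarrow> 0" "AE \<omega> in M. (\<lambda>n. Z' (r n) \<omega>) \<longlonglongrightarrow> 0"
proof -
  have ev: "eventually (\<lambda>n. prob {\<omega> \<in> space M. ennreal ((1/2) ^ k) \<le> Y n \<omega>} < (1/2) ^ k) sequentially"
    if "tends_to_0_in_probability M Y" for Y and k :: nat
    by (rule order_tendstoD(2)[where y=0]) (use that in \<open>simp_all add: tends_to_0_in_probability_def\<close>)
  have "\<exists>n. prob {\<omega> \<in> space M. ennreal ((1/2) ^ k) \<le> Z n \<omega>} < (1/2) ^ k \<and>
      prob {\<omega> \<in> space M. ennreal ((1/2) ^ k) \<le> Z' n \<omega>} < (1/2) ^ k" for k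
    using eventually_conj[OF ev[OF lim(1), of k] ev[OF lim(2), of k]]
    by (rule eventually_happens'[OF sequentially_bot])
  then have "\<exists>r. \<forall>k. prob {\<omega> \<in> space M. ennreal ((1/2) ^ k) \<le> Z (r k) \<omega>} < (1/2) ^ k \<and>
      prob {\<omega> \<in> space M. ennreal ((1/2) ^ k) \<le> Z' (r k) \<omega>} < (1/2) ^ k"
    by (intro choice allI)
  then obtain r where r: "\<And>k. prob {\<omega> \<in> space M. ennreal ((1/2) ^ k) \<le> Z (r k) \<omega>} < (1/2) ^ k"
      "\<And>k. prob {\<omega> \<in> space M. ennreal ((1/2) ^ k) \<le> Z' (r k) \<omega>} < (1/2) ^ k"
    by blast
  show thesis
    using AE_tendsto_0_fast[OF meas(1) r(1)] AE_tendsto_0_fast[OF meas(2) r(2)] by (rule that)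
qed

section \<open>Regularity of elementary integrals and simple processes\<close>

lemma simple_integrand_grid_nonneg:
  assumes "simple_integrand M F N \<tau> \<xi>" "i \<le> N"
  shows "0 \<le> \<tau> i"
proof -
  have "\<tau> 0 \<le> \<tau> i"
    using assms(1) by (intro Suc_mono_upto[OF _ _ assms(2), where f=\<tau>]) (simp_all add: simple_integrand_def)
  then show ?thesis
    using assms(1) by (simp add: simple_integrand_def)
qed

lemma simple_integral_measurable:
  assumes F: "filtered_prob_space M F" and B: "adapted F B" and "simple_integrand M F N \<tau> \<xi>" and "0 \<le> t"
  shows "simple_integral N \<tau> \<xi> B t \<in> borel_measurable M"
proof -
  have "0 \<le> \<tau> i" if "i \<le> N" for i
    using simple_integrand_grid_nonneg[OF assms(3) that] .
  then have "B (min t (\<tau> i)) \<in> borel_measurable M" if "i \<le> N" for i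
    using that B \<open>0 \<le> t\<close> by (intro filtered_measurable_M[OF F, of _ "min t (\<tau> i)"]) (auto simp: adapted_def)
  moreover have "\<xi> i \<in> borel_measurable M" if "i < N" for i
    using that assms(3) filtered_measurable_M[OF F, of "\<xi> i" "\<tau> i"] by (auto simp: simple_integrand_def)
  ultimately show ?thesis
    unfolding simple_integral_def[abs_def]
    by (intro borel_measurable_sum borel_measurable_times borel_measurable_diff) auto
qed

lemma simple_integral_continuous:
  assumes B: "continuous_on {0..} (\<lambda>t. B t \<omega>)" and \<xi>: "simple_integrand M F N \<tau> \<xi>"
  shows "continuous_on {0..T} (\<lambda>t. simple_integral N \<tau> \<xi> B t \<omega>)"
  unfolding simple_integral_def
  using simple_integrand_grid_nonneg[OF \<xi>]
  by (intro continuous_intros continuous_on_compose2[OF B]) auto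

lemma simple_process_measurable:
  assumes F: "filtered_prob_space M F" and \<xi>: "simple_integrand M F N \<tau> \<xi>"
  shows "(\<lambda>(t, \<omega>). simple_process N \<tau> \<xi> t \<omega>) \<in> borel_measurable (borel \<Otimes>\<^sub>M M)"
proof -
  have "\<xi> i \<in> borel_measurable M" if "i < N" for i
    using that \<xi> filtered_measurable_M[OF F, of "\<xi> i" "\<tau> i"] by (auto simp: simple_integrand_def)
  then show ?thesis
    unfolding simple_process_def case_prod_beta
    by (intro borel_measurable_sum borel_measurable_times measurable_compose[OF measurable_snd]
        measurable_compose[OF measurable_fst]) auto
qed

lemma ito_integral_AE_approximation:
  assumes F: "filtered_prob_space M F" and B: "brownian_motion M F B" and I: "ito_integral M F B H I" and "0 \<le> T"
  obtains N \<tau> \<xi> where "\<And>n. simple_integrand M F (N n) (\<tau> n) (\<xi> n)"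
    and "AE \<omega> in M. (\<lambda>n. \<integral>\<^sup>+ t\<in>{0..T}. ennreal ((simple_process (N n) (\<tau> n) (\<xi> n) t \<omega> - H t \<omega>)\<^sup>2) \<partial>lborel) \<longlonglongrightarrow> 0"
    and "AE \<omega> in M. \<forall>t\<in>{0..T}. (\<lambda>n. simple_integral (N n) (\<tau> n) (\<xi> n) B t \<omega>) \<longlonglongrightarrow> I t \<omega>"
proof -
  interpret prob_space M by (rule filtered_prob_space_prob_space[OF F])
  from I obtain N \<tau> \<xi> where \<xi>: "\<And>n. simple_integrand M F (N n) (\<tau> n) (\<xi> n)"
    and lim: "tends_to_0_in_probability M (\<lambda>n \<omega>.
             \<integral>\<^sup>+ t\<in>{0..T}. ennreal ((simple_process (N n) (\<tau> n) (\<xi> n) t \<omega> - H t \<omega>)\<^sup>2) \<partial>lborel)"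
         "tends_to_0_in_probability M (\<lambda>n \<omega>.
             SUP t\<in>{0..T}. ennreal \<bar>simple_integral (N n) (\<tau> n) (\<xi> n) B t \<omega> - I t \<omega>\<bar>)"
    using \<open>0 \<le> T\<close> unfolding ito_integral_def by blast
  have I': "adapted F I" "continuous_paths M I" "progressively_measurable F H"
    using I by (auto simp: ito_integral_def)
  note B' = brownian_motion_adapted[OF B] brownian_motion_continuous[OF B]
  \<comment> \<open>Measurability is essential: \<open>measure\<close> gives 0 to non-measurable
    sets, so the convergence in probability of the definition carries information only once these
    random variables are known to be measurable.\<close>
  have meas1: "(\<lambda>\<omega>. \<integral>\<^sup>+ t\<in>{0..T}. ennreal ((simple_process (N n) (\<tau> n) (\<xi> n) t \<omega> - H t \<omega>)\<^sup>2) \<partial>lborel)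
      \<in> borel_measurable M" for n
  proof -
    note [measurable] = progressively_measurable_joint[OF F I'(3) \<open>0 \<le> T\<close>, unfolded case_prod_beta]
      simple_process_measurable[OF F \<xi>[of n], unfolded case_prod_beta]
    have eq: "ennreal ((simple_process (N n) (\<tau> n) (\<xi> n) t \<omega> - H t \<omega>)\<^sup>2) * indicator {0..T} t
        = ennreal ((simple_process (N n) (\<tau> n) (\<xi> n) t \<omega> - indicator {0..T} t * H t \<omega>)\<^sup>2) * indicator {0..T} t" for t \<omega>
      by (simp split: split_indicator)
    show ?thesis
      unfolding eq
    proof (rule lborel.borel_measurable_nn_integral)
      have "(\<lambda>z. ennreal ((simple_process (N n) (\<tau> n) (\<xi> n) (fst z) (snd z) - indicator {0..T} (fst z) * H (fst z) (snd z))\<^sup>2)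
          * indicator {0..T} (fst z)) \<in> borel_measurable (borel \<Otimes>\<^sub>M M)"
        by measurable
      from measurable_compose[OF measurable_pair_swap' this]
      show "(\<lambda>(\<omega>, t). ennreal ((simple_process (N n) (\<tau> n) (\<xi> n) t \<omega> - indicator {0..T} t * H t \<omega>)\<^sup>2)
          * indicator {0..T} t) \<in> borel_measurable (M \<Otimes>\<^sub>M lborel)"
        by (simp add: case_prod_beta cong: measurable_cong_sets sets_pair_measure_cong)
    qed
  qed
  have meas2: "(\<lambda>\<omega>. SUP t\<in>{0..T}. ennreal \<bar>simple_integral (N n) (\<tau> n) (\<xi> n) B t \<omega> - I t \<omega>\<bar>) \<in> borel_measurable M" for n
  proof (rule borel_measurable_SUP_continuous)
    show "(\<lambda>\<omega>. simple_integral (N n) (\<tau> n) (\<xi> n) B t \<omega> - I t \<omega>) \<in> borel_measurable M" if "t \<in> {0..T}" for t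
      using that I'(1) by (intro borel_measurable_diff simple_integral_measurable[OF F B'(1) \<xi>] filtered_measurable_M[OF F])
        (auto simp: adapted_def)
    show "continuous_on {0..T} (\<lambda>t. simple_integral (N n) (\<tau> n) (\<xi> n) B t \<omega> - I t \<omega>)" if "\<omega> \<in> space M" for \<omega>
      using that B'(2) I'(2)
      by (intro continuous_on_diff simple_integral_continuous[OF _ \<xi>])
        (auto simp: continuous_paths_def intro: continuous_on_subset)
  qed
  obtain r where r: "AE \<omega> in M. (\<lambda>n. \<integral>\<^sup>+ t\<in>{0..T}. ennreal ((simple_process (N (r n)) (\<tau> (r n)) (\<xi> (r n)) t \<omega> - H t \<omega>)\<^sup>2) \<partial>lborel) \<longlonglongrightarrow> 0"
     "AE \<omega> in M. (\<lambda>n. SUP t\<in>{0..T}. ennreal \<bar>simple_integral (N (r n)) (\<tau> (r n)) (\<xi> (r n)) B t \<omega> - I t \<omega>\<bar>) \<longlonglongrightarrow> 0"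
    using tends_to_0_in_probability_AE_subseq[OF meas1 meas2 lim] by blast
  show thesis
  proof (rule that[of "\<lambda>n. N (r n)" "\<lambda>n. \<tau> (r n)" "\<lambda>n. \<xi> (r n)", OF \<xi> r(1)])
    show "AE \<omega> in M. \<forall>t\<in>{0..T}. (\<lambda>n. simple_integral (N (r n)) (\<tau> (r n)) (\<xi> (r n)) B t \<omega>) \<longlonglongrightarrow> I t \<omega>"
      using r(2)
    proof eventually_elim
      case (elim \<omega>)
      show ?case
      proof
        fix t assume t: "t \<in> {0..T}"
        have "(\<lambda>n. ennreal \<bar>simple_integral (N (r n)) (\<tau> (r n)) (\<xi> (r n)) B t \<omega> - I t \<omega>\<bar>) \<longlonglongrightarrow> 0"
          by (rule tendsto_sandwich[OF _ _ tendsto_const elim]) (use t in \<open>auto intro!: always_eventually SUP_upper\<close>)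
        then have "(\<lambda>n. ennreal \<bar>simple_integral (N (r n)) (\<tau> (r n)) (\<xi> (r n)) B t \<omega> - I t \<omega>\<bar>) \<longlonglongrightarrow> ennreal 0"
          by simp
        then have "(\<lambda>n. \<bar>simple_integral (N (r n)) (\<tau> (r n)) (\<xi> (r n)) B t \<omega> - I t \<omega>\<bar>) \<longlonglongrightarrow> 0"
          by (rule tendsto_ennrealD) simp_all
        then show "(\<lambda>n. simple_integral (N (r n)) (\<tau> (r n)) (\<xi> (r n)) B t \<omega>) \<longlonglongrightarrow> I t \<omega>"
          by (simp add: tendsto_rabs_zero_iff LIM_zero_iff)
      qed
    qed
  qed
qed

section \<open>Exponential identity for Ito integrals\<close>

text \<open>The squared norm is continuous under L^2 convergence. Young's inequality with a free
  weight \<open>e\<close> takes the place of the triangle inequality: for fixed \<open>e\<close> the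
  first term of the bound vanishes in the limit, and the second is small with
  \<open>e\<close>.\<close>

lemma integral_square_limit:
  fixes h :: "nat \<Rightarrow> 'a \<Rightarrow> real"
  assumes h[measurable]: "\<And>n. h n \<in> borel_measurable M" and H[measurable]: "H \<in> borel_measurable M"
    and h2: "\<And>n. integrable M (\<lambda>x. (h n x)\<^sup>2)" and H2: "integrable M (\<lambda>x. (H x)\<^sup>2)"
    and lim: "(\<lambda>n. \<integral>\<^sup>+x. ennreal ((h n x - H x)\<^sup>2) \<partial>M) \<longlonglongrightarrow> 0"
  shows "(\<lambda>n. \<integral>x. (h n x)\<^sup>2 \<partial>M) \<longlonglongrightarrow> (\<integral>x. (H x)\<^sup>2 \<partial>M)"
proof -
  let ?V = "\<integral>x. (H x)\<^sup>2 \<partial>M" and ?d = "\<lambda>n. \<integral>x. (h n x - H x)\<^sup>2 \<partial>M"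
  have "0 \<le> ?V" by simp
  have d: "integrable M (\<lambda>x. (h n x - H x)\<^sup>2)" for n
  proof (rule Bochner_Integration.integrable_bound)
    show "integrable M (\<lambda>x. 2 * (h n x)\<^sup>2 + 2 * (H x)\<^sup>2)"
      using h2 H2 by simp
    have "(x - y)\<^sup>2 \<le> 2 * x\<^sup>2 + 2 * y\<^sup>2" for x y :: real
      using zero_le_power2[of "x + y"] by (simp add: power2_sum power2_diff)
    then show "AE x in M. norm ((h n x - H x)\<^sup>2) \<le> norm (2 * (h n x)\<^sup>2 + 2 * (H x)\<^sup>2)"
      by simp
  qed measurable
  have "(\<lambda>n. ennreal (?d n)) \<longlonglongrightarrow> 0"
    using lim by (subst (asm) nn_integral_eq_integral[OF d]) auto
  then have d_lim: "?d \<longlonglongrightarrow> 0"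
    by (subst (asm) ennreal_tendsto_0_iff) auto
  have bound: "\<bar>(\<integral>x. (h n x)\<^sup>2 \<partial>M) - ?V\<bar> \<le> (1 / (2 * e) + e) * ?d n + 4 * e * ?V" if "0 < e" for n e
  proof -
    \<comment> \<open>From \<open>2 |x - y| e |x + y| \<le> (x - y)\<^sup>2 + e\<^sup>2 (x +
      y)\<^sup>2\<close> and \<open>(x + y)\<^sup>2 \<le> 2 (x - y)\<^sup>2 + 8 y\<^sup>2\<close>,
      the latter being \<open>(x - 3 y)\<^sup>2 \<ge> 0\<close>.\<close>
    have pt: "\<bar>x\<^sup>2 - y\<^sup>2\<bar> \<le> (1 / (2 * e) + e) * (x - y)\<^sup>2 + 4 * e * y\<^sup>2" for x y :: real
    proof -
      have "2 * e * \<bar>x\<^sup>2 - y\<^sup>2\<bar> = 2 * \<bar>x - y\<bar> * (e * \<bar>x + y\<bar>)"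
        by (simp add: power2_eq_square abs_mult[symmetric] algebra_simps)
      also have "\<dots> \<le> (x - y)\<^sup>2 + (e * (x + y))\<^sup>2"
        using sum_squares_bound[of "\<bar>x - y\<bar>" "e * \<bar>x + y\<bar>"] by (simp add: power_mult_distrib)
      also have "\<dots> \<le> (x - y)\<^sup>2 + e\<^sup>2 * (2 * (x - y)\<^sup>2 + 8 * y\<^sup>2)"
      proof -
        have "(x + y)\<^sup>2 \<le> 2 * (x - y)\<^sup>2 + 8 * y\<^sup>2"
          using zero_le_power2[of "x - 3 * y"] by (simp add: power2_eq_square algebra_simps)
        then show ?thesis by (simp add: power_mult_distrib mult_left_mono)
      qed
      also have "\<dots> = 2 * e * ((1 / (2 * e) + e) * (x - y)\<^sup>2 + 4 * e * y\<^sup>2)"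
        using that by (simp add: field_simps power2_eq_square)
      finally show ?thesis using that by simp
    qed
    have "\<bar>(\<integral>x. (h n x)\<^sup>2 \<partial>M) - ?V\<bar> = \<bar>\<integral>x. (h n x)\<^sup>2 - (H x)\<^sup>2 \<partial>M\<bar>"
      using h2 H2 by simp
    also have "\<dots> \<le> (\<integral>x. \<bar>(h n x)\<^sup>2 - (H x)\<^sup>2\<bar> \<partial>M)"
      by (rule integral_abs_bound)
    also have "\<dots> \<le> (\<integral>x. (1 / (2 * e) + e) * (h n x - H x)\<^sup>2 + 4 * e * (H x)\<^sup>2 \<partial>M)"
      using h2 H2 d by (intro integral_mono pt) auto
    also have "\<dots> = (1 / (2 * e) + e) * ?d n + 4 * e * ?V"
      using h2 H2 d by simp
    finally show ?thesis .
  qed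
  show ?thesis
  proof (rule tendstoI)
    fix \<epsilon> :: real assume "0 < \<epsilon>"
    \<comment> \<open>Makes \<open>4 * e * ?V\<close> at most half of \<epsilon>; the added 1 keeps
      the denominator positive when \<open>?V\<close> is 0.\<close>
    define e where "e = \<epsilon> / (8 * (?V + 1))"
    have "0 < ?V + 1" using \<open>0 \<le> ?V\<close> by linarith
    then have e: "0 < e"
      unfolding e_def using \<open>0 < \<epsilon>\<close> by (intro divide_pos_pos mult_pos_pos) simp_all
    have "4 * e * ?V < \<epsilon>"
    proof -
      have "4 * e * ?V \<le> 4 * e * (?V + 1)" using e by (intro mult_left_mono) simp_all
      also have "\<dots> = \<epsilon> / 2" using \<open>0 < ?V + 1\<close> unfolding e_def by (simp del: distrib_left_numeral)
      finally show ?thesis using \<open>0 < \<epsilon>\<close> by simp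
    qed
    moreover have "(\<lambda>n. (1 / (2 * e) + e) * ?d n + 4 * e * ?V) \<longlonglongrightarrow> (1 / (2 * e) + e) * 0 + 4 * e * ?V"
      by (intro tendsto_intros d_lim)
    ultimately have "eventually (\<lambda>n. (1 / (2 * e) + e) * ?d n + 4 * e * ?V < \<epsilon>) sequentially"
      by (intro order_tendstoD(2)[of _ "(1 / (2 * e) + e) * 0 + 4 * e * ?V"]) auto
    then show "eventually (\<lambda>n. dist (\<integral>x. (h n x)\<^sup>2 \<partial>M) ?V < \<epsilon>) sequentially"
    proof eventually_elim
      case (elim n)
      with bound[OF e, of n] show ?case by (simp add: dist_real_def)
    qed
  qed
qed

section \<open>Restriction of simple integrands to an interval \<open>[s, t]\<close>\<close>

definition clip_grid :: "real \<Rightarrow> real \<Rightarrow> (nat \<Rightarrow> real) \<Rightarrow> nat \<Rightarrow> real" where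
  "clip_grid s t \<tau> i = max s (min t (\<tau> i))"

text \<open>
  On intervals that clipping makes degenerate the coefficient is set to 0, since \<open>\<xi> i\<close> need not be
  measurable at the clipped time.
\<close>

definition clip_integrand :: "real \<Rightarrow> real \<Rightarrow> (nat \<Rightarrow> real) \<Rightarrow> (nat \<Rightarrow> 'a \<Rightarrow> real) \<Rightarrow> nat \<Rightarrow> 'a \<Rightarrow> real" where
  "clip_integrand s t \<tau> \<xi> i = (if clip_grid s t \<tau> i < clip_grid s t \<tau> (Suc i) then \<xi> i else (\<lambda>_. 0))"

text \<open>Clipping projects all grid points to \<open>[s, t]\<close> but keeps their number, so no
  index has to be shifted; intervals outside become degenerate instead of being removed.\<close>

lemma grid_integrand_clip:
  assumes F: "filtered_prob_space M F" and \<xi>: "simple_integrand M F N \<tau> \<xi>" and "s \<le> t"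
  shows "grid_integrand F s N (clip_grid s t \<tau>) (clip_integrand s t \<tau> \<xi>)"
proof -
  have "clip_integrand s t \<tau> \<xi> i \<in> borel_measurable (F (clip_grid s t \<tau> i))" if "i < N" for i
  proof (cases "clip_grid s t \<tau> i < clip_grid s t \<tau> (Suc i)")
    case True
    \<comment> \<open>A grid point beyond its clipped value has been clipped to \<open>t\<close>,
      and then its interval is degenerate. So on a proper interval the coefficient is already known
      at the clipped left end.\<close>
    then have "\<tau> i \<le> clip_grid s t \<tau> i"
      using \<open>s \<le> t\<close> by (auto simp: clip_grid_def)
    moreover have "\<xi> i \<in> borel_measurable (F (\<tau> i))"
      using \<xi> that by (simp add: simple_integrand_def)
    ultimately show ?thesis
      using True filtered_measurable_mono[OF F] by (auto simp: clip_integrand_def)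
  qed (simp add: clip_integrand_def)
  moreover have "clip_grid s t \<tau> i \<le> clip_grid s t \<tau> (Suc i)" if "i < N" for i
    using \<xi> that by (auto simp: simple_integrand_def clip_grid_def min_def max_def)
  ultimately show ?thesis
    by (simp add: grid_integrand_def) (simp add: clip_grid_def)
qed

lemma grid_integral_clip:
  assumes \<xi>: "simple_integrand M F N \<tau> \<xi>" and "s \<le> t"
  shows "grid_integral N (clip_grid s t \<tau>) (clip_integrand s t \<tau> \<xi>) B \<omega>
    = simple_integral N \<tau> \<xi> B t \<omega> - simple_integral N \<tau> \<xi> B s \<omega>"
proof -
  \<comment> \<open>Checked separately for a grid point left of \<open>s\<close>, in between, and
    right of \<open>t\<close>. The summand \<open>B s\<close> cancels in differences, leaving the
    increments up to \<open>t\<close> minus those up to \<open>s\<close>.\<close>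
  have B: "B (clip_grid s t \<tau> i) \<omega> = B (min t (\<tau> i)) \<omega> - B (min s (\<tau> i)) \<omega> + B s \<omega>" for i
    using \<open>s \<le> t\<close> by (auto simp: clip_grid_def min_def max_def)
  have "clip_integrand s t \<tau> \<xi> i \<omega> * (B (clip_grid s t \<tau> (Suc i)) \<omega> - B (clip_grid s t \<tau> i) \<omega>)
    = \<xi> i \<omega> * (B (clip_grid s t \<tau> (Suc i)) \<omega> - B (clip_grid s t \<tau> i) \<omega>)" if "i < N" for i
  proof -
    have "clip_grid s t \<tau> i \<le> clip_grid s t \<tau> (Suc i)"
      using \<xi> that by (auto simp: simple_integrand_def clip_grid_def min_def max_def)
    then show ?thesis
      by (cases "clip_grid s t \<tau> i = clip_grid s t \<tau> (Suc i)") (auto simp: clip_integrand_def)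
  qed
  then show ?thesis
    unfolding grid_integral_def simple_integral_def sum_subtractf[symmetric] B
    by (intro sum.cong) (auto simp: algebra_simps)
qed

text \<open>The half-open grid intervals are pairwise disjoint, so the cross terms vanish.\<close>

lemma simple_process_square:
  assumes "\<And>i. i < N \<Longrightarrow> \<tau> i \<le> \<tau> (Suc i)"
  shows "(simple_process N \<tau> \<xi> u \<omega>)\<^sup>2 = (\<Sum>i<N. (\<xi> i \<omega>)\<^sup>2 * indicator {\<tau> i<..\<tau> (Suc i)} u)"
  using assms
proof (induction N)
  case (Suc N)
  have le: "\<tau> i \<le> \<tau> N" if "i \<le> N" for i
    by (intro Suc_mono_upto[OF _ that order_refl, where f=\<tau>]) (simp add: Suc.prems)
  have "simple_process N \<tau> \<xi> u \<omega> * indicator {\<tau> N<..\<tau> (Suc N)} u = 0"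
  proof (cases "u \<in> {\<tau> N<..\<tau> (Suc N)}")
    case True
    have "indicator {\<tau> i<..\<tau> (Suc i)} u = (0 :: real)" if "i < N" for i
      using True le[of "Suc i"] that by (auto simp: indicator_def)
    then show ?thesis by (simp add: simple_process_def)
  qed simp
  moreover have "simple_process (Suc N) \<tau> \<xi> u \<omega> = simple_process N \<tau> \<xi> u \<omega> + \<xi> N \<omega> * indicator {\<tau> N<..\<tau> (Suc N)} u"
    by (simp add: simple_process_def)
  moreover have "(indicator {\<tau> N<..\<tau> (Suc N)} u :: real)\<^sup>2 = indicator {\<tau> N<..\<tau> (Suc N)} u"
    by (simp split: split_indicator)
  ultimately have "(simple_process (Suc N) \<tau> \<xi> u \<omega>)\<^sup>2
      = (simple_process N \<tau> \<xi> u \<omega>)\<^sup>2 + (\<xi> N \<omega>)\<^sup>2 * indicator {\<tau> N<..\<tau> (Suc N)} u"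
    by (auto simp: power2_sum power_mult_distrib)
  then show ?case using Suc by simp
qed (simp add: simple_process_def)

lemma has_bochner_integral_clip:
  fixes a b :: real
  assumes "a \<le> b" "s \<le> t"
  shows "has_bochner_integral lborel (\<lambda>u. indicator {s..t} u * indicator {a<..b} u)
    (max s (min t b) - max s (min t a))"
proof -
  have m: "emeasure lborel ({s..t} \<inter> {a<..b}) = ennreal (max s (min t b) - max s (min t a))"
  proof (cases "a < s")
    case True
    then have "{s..t} \<inter> {a<..b} = {s..min t b}" by auto
    moreover have "max s (min t a) = s" using True by simp
    ultimately show ?thesis
      using assms by (cases "s \<le> min t b") auto
  next
    case False
    then have "{s..t} \<inter> {a<..b} = {a<..min t b}" by auto
    then show ?thesis
      using assms False by (cases "a \<le> min t b") (auto simp: min_def max_def)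
  qed
  have "has_bochner_integral lborel (\<lambda>u. indicator ({s..t} \<inter> {a<..b}) u)
      (measure lborel ({s..t} \<inter> {a<..b}))"
    by (rule has_bochner_integral_real_indicator) (auto simp: m)
  moreover have "measure lborel ({s..t} \<inter> {a<..b}) = max s (min t b) - max s (min t a)"
    using assms by (intro measure_eq_emeasure_eq_ennreal m) auto
  ultimately show ?thesis
    unfolding indicator_inter_arith by simp
qed

text \<open>This turns convergence of the grid variations into a statement about L^2 convergence of
  integrands in time, path by path.\<close>

lemma has_bochner_integral_simple_process_square:
  assumes \<xi>: "simple_integrand M F N \<tau> \<xi>" and "s \<le> t"
  shows "has_bochner_integral lborel (\<lambda>u. (indicator {s..t} u * simple_process N \<tau> \<xi> u \<omega>)\<^sup>2)
    (grid_variation N (clip_grid s t \<tau>) (clip_integrand s t \<tau> \<xi>) \<omega>)"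
proof -
  have mono: "\<tau> i \<le> \<tau> (Suc i)" if "i < N" for i
    using \<xi> that by (simp add: simple_integrand_def)
  have "has_bochner_integral lborel
      (\<lambda>u. \<Sum>i<N. (\<xi> i \<omega>)\<^sup>2 * (indicator {s..t} u * indicator {\<tau> i<..\<tau> (Suc i)} u))
      (\<Sum>i<N. (\<xi> i \<omega>)\<^sup>2 * (clip_grid s t \<tau> (Suc i) - clip_grid s t \<tau> i))"
    unfolding clip_grid_def
    by (intro has_bochner_integral_sum has_bochner_integral_mult_right has_bochner_integral_clip mono \<open>s \<le> t\<close>) auto
  moreover have "(\<Sum>i<N. (\<xi> i \<omega>)\<^sup>2 * (indicator {s..t} u * indicator {\<tau> i<..\<tau> (Suc i)} u))
      = (indicator {s..t} u * simple_process N \<tau> \<xi> u \<omega>)\<^sup>2" for u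
    using simple_process_square[of N \<tau> \<xi> u \<omega>, OF mono]
    by (auto simp: power_mult_distrib split: split_indicator)
  moreover have "(\<Sum>i<N. (\<xi> i \<omega>)\<^sup>2 * (clip_grid s t \<tau> (Suc i) - clip_grid s t \<tau> i))
      = grid_variation N (clip_grid s t \<tau>) (clip_integrand s t \<tau> \<xi>) \<omega>"
    unfolding grid_variation_def
  proof (rule sum.cong[OF refl])
    fix i assume "i \<in> {..<N}"
    then have "clip_grid s t \<tau> i \<le> clip_grid s t \<tau> (Suc i)"
      using mono[of i] by (auto simp: clip_grid_def min_def max_def)
    then show "(\<xi> i \<omega>)\<^sup>2 * (clip_grid s t \<tau> (Suc i) - clip_grid s t \<tau> i)
        = (clip_integrand s t \<tau> \<xi> i \<omega>)\<^sup>2 * (clip_grid s t \<tau> (Suc i) - clip_grid s t \<tau> i)"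
      by (cases "clip_grid s t \<tau> i = clip_grid s t \<tau> (Suc i)") (auto simp: clip_integrand_def)
  qed
  ultimately show ?thesis by simp
qed

section \<open>Measurability and square integrability of the limiting integrand\<close>

lemma ito_integrand_measurable:
  assumes F: "filtered_prob_space M F" and H: "progressively_measurable F H" and "0 \<le> s" and \<omega>: "\<omega> \<in> space M"
  shows "(\<lambda>u. indicator {s..t} u * H u \<omega>) \<in> borel_measurable borel"
proof (cases "s \<le> t")
  case True
  then have "0 \<le> t" using \<open>0 \<le> s\<close> by simp
  have "(\<lambda>u. indicator {0..t} u * H u \<omega>) \<in> borel_measurable borel"
    using measurable_compose[OF measurable_Pair2'[OF \<omega>] progressively_measurable_joint[OF F H \<open>0 \<le> t\<close>]]
    by simp
  then have "(\<lambda>u. indicator {s..t} u * (indicator {0..t} u * H u \<omega>)) \<in> borel_measurable borel"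
    by measurable
  moreover have "indicator {s..t} u * (indicator {0..t} u * H u \<omega>) = indicator {s..t} u * H u \<omega>" for u
    using \<open>0 \<le> s\<close> by (simp split: split_indicator)
  ultimately show ?thesis by simp
qed simp

lemma ito_integrand_square_integrable:
  assumes F: "filtered_prob_space M F" and H: "progressively_measurable F H" and \<omega>: "\<omega> \<in> space M"
    and fin: "(\<integral>\<^sup>+ u\<in>{0..t}. ennreal ((H u \<omega>)\<^sup>2) \<partial>lborel) < \<infinity>" and "0 \<le> s" "r \<le> t"
  shows "integrable lborel (\<lambda>u. (indicator {s..r} u * H u \<omega>)\<^sup>2)"
    and "set_integrable lborel {s..r} (\<lambda>u. (H u \<omega>)\<^sup>2)"
    and "(LBINT u:{s..r}. (H u \<omega>)\<^sup>2) = (\<integral>u. (indicator {s..r} u * H u \<omega>)\<^sup>2 \<partial>lborel)"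
proof -
  note [measurable] = ito_integrand_measurable[OF F H \<open>0 \<le> s\<close> \<omega>, of r]
  show i: "integrable lborel (\<lambda>u. (indicator {s..r} u * H u \<omega>)\<^sup>2)"
  proof (rule integrableI_bounded)
    have "(\<integral>\<^sup>+u. ennreal (norm ((indicator {s..r} u * H u \<omega>)\<^sup>2)) \<partial>lborel)
        \<le> (\<integral>\<^sup>+ u\<in>{0..t}. ennreal ((H u \<omega>)\<^sup>2) \<partial>lborel)"
      using \<open>0 \<le> s\<close> \<open>r \<le> t\<close> by (intro nn_integral_mono) (auto split: split_indicator)
    then show "(\<integral>\<^sup>+u. ennreal (norm ((indicator {s..r} u * H u \<omega>)\<^sup>2)) \<partial>lborel) < \<infinity>"
      using fin by (rule le_less_trans)
  qed simp
  have eq: "(indicator {s..r} u * H u \<omega>)\<^sup>2 = indicator {s..r} u *\<^sub>R (H u \<omega>)\<^sup>2" for u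
    by (simp split: split_indicator)
  show "set_integrable lborel {s..r} (\<lambda>u. (H u \<omega>)\<^sup>2)"
    using i unfolding set_integrable_def eq .
  show "(LBINT u:{s..r}. (H u \<omega>)\<^sup>2) = (\<integral>u. (indicator {s..r} u * H u \<omega>)\<^sup>2 \<partial>lborel)"
    unfolding set_lebesgue_integral_def eq ..
qed

lemma ito_variation_measurable:
  assumes F: "filtered_prob_space M F" and H: "progressively_measurable F H" and "0 \<le> s" "s \<le> t"
  shows "(\<lambda>\<omega>. LBINT u:{s..t}. (H u \<omega>)\<^sup>2) \<in> borel_measurable M"
proof -
  have "0 \<le> t" using assms by simp
  note [measurable] = progressively_measurable_joint[OF F H \<open>0 \<le> t\<close>, unfolded case_prod_beta]
  have "(\<lambda>z. indicator {s..t} (fst z) *\<^sub>R (indicator {0..t} (fst z) * H (fst z) (snd z))\<^sup>2) \<in> borel_measurable (borel \<Otimes>\<^sub>M M)"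
    by measurable
  from measurable_compose[OF measurable_pair_swap' this]
  have "(\<lambda>(\<omega>, u). indicator {s..t} u *\<^sub>R (indicator {0..t} u * H u \<omega>)\<^sup>2) \<in> borel_measurable (M \<Otimes>\<^sub>M lborel)"
    by (simp add: case_prod_beta cong: measurable_cong_sets sets_pair_measure_cong)
  from lborel.borel_measurable_lebesgue_integral[OF this]
  have "(\<lambda>\<omega>. \<integral>u. indicator {s..t} u *\<^sub>R (indicator {0..t} u * H u \<omega>)\<^sup>2 \<partial>lborel) \<in> borel_measurable M" .
  moreover have eq: "indicator {s..t} u *\<^sub>R (indicator {0..t} u * H u \<omega>)\<^sup>2 = indicator {s..t} u *\<^sub>R (H u \<omega>)\<^sup>2" for u \<omega>
    using \<open>0 \<le> s\<close> by (simp split: split_indicator)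
  ultimately show ?thesis
    unfolding set_lebesgue_integral_def eq by blast
qed

text \<open>The clipped approximations, scaled by \<open>a\<close>, satisfy the hypotheses of
  \<open>nn_integral_exp_limit\<close>. The factor is kept general because \<open>a = 1\<close>
  serves the stock price and arbitrary \<open>a\<close> the moment generating function of the
  noise.\<close>

lemma ito_integral_exponential:
  assumes F: "filtered_prob_space M F" and B: "brownian_motion M F B" and I: "ito_integral M F B H I"
    and st: "0 \<le> s" "s \<le> t" and A: "A \<in> sets (F s)"
    and fin: "(\<integral>\<^sup>+\<omega>. ennreal (exp (6 * (a\<^sup>2 * (LBINT u:{s..t}. (H u \<omega>)\<^sup>2)))) \<partial>M) < \<infinity>"
  shows "(\<integral>\<^sup>+\<omega>. indicator A \<omega> * ennreal (exp (a * (I t \<omega> - I s \<omega>) - a\<^sup>2 * (LBINT u:{s..t}. (H u \<omega>)\<^sup>2) / 2)) \<partial>M)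
    = emeasure M A"
proof -
  have "0 \<le> t" using st by simp
  have H: "progressively_measurable F H" and I': "adapted F I"
    and H2: "AE \<omega> in M. \<forall>T\<ge>0. (\<integral>\<^sup>+ u\<in>{0..T}. ennreal ((H u \<omega>)\<^sup>2) \<partial>lborel) < \<infinity>"
    using I unfolding ito_integral_def by blast+
  obtain N \<tau> \<xi> where \<xi>: "\<And>n. simple_integrand M F (N n) (\<tau> n) (\<xi> n)"
    and h_lim: "AE \<omega> in M. (\<lambda>n. \<integral>\<^sup>+ u\<in>{0..t}. ennreal ((simple_process (N n) (\<tau> n) (\<xi> n) u \<omega> - H u \<omega>)\<^sup>2) \<partial>lborel) \<longlonglongrightarrow> 0"
    and I_lim: "AE \<omega> in M. \<forall>u\<in>{0..t}. (\<lambda>n. simple_integral (N n) (\<tau> n) (\<xi> n) B u \<omega>) \<longlonglongrightarrow> I u \<omega>"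
    by (rule ito_integral_AE_approximation[OF F B I \<open>0 \<le> t\<close>]) (rule that)
  show ?thesis
  proof (rule nn_integral_exp_limit[where N=N and \<sigma>="\<lambda>n. clip_grid s t (\<tau> n)"
        and \<xi>="\<lambda>n i \<omega>. a * clip_integrand s t (\<tau> n) (\<xi> n) i \<omega>"
        and J="\<lambda>\<omega>. a * (I t \<omega> - I s \<omega>)" and V="\<lambda>\<omega>. a\<^sup>2 * (LBINT u:{s..t}. (H u \<omega>)\<^sup>2)",
        OF F B st(1) A _ _ _ _ _ fin])
    show "grid_integrand F s (N n) (clip_grid s t (\<tau> n)) (\<lambda>i \<omega>. a * clip_integrand s t (\<tau> n) (\<xi> n) i \<omega>)" for n
      by (rule grid_scale(3)[OF grid_integrand_clip[OF F \<xi> st(2)]])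
    show "(\<lambda>\<omega>. a * (I t \<omega> - I s \<omega>)) \<in> borel_measurable M"
    proof -
      have "I u \<in> borel_measurable M" if "0 \<le> u" for u
        using I' that by (intro filtered_measurable_M[OF F, of "I u" u]) (simp add: adapted_def)
      with \<open>0 \<le> t\<close> st(1) show ?thesis by simp
    qed
    show "(\<lambda>\<omega>. a\<^sup>2 * (LBINT u:{s..t}. (H u \<omega>)\<^sup>2)) \<in> borel_measurable M"
      using ito_variation_measurable[OF F H st] by simp
    show "AE \<omega> in M. (\<lambda>n. grid_integral (N n) (clip_grid s t (\<tau> n)) (\<lambda>i \<omega>. a * clip_integrand s t (\<tau> n) (\<xi> n) i \<omega>) B \<omega>)
        \<longlonglongrightarrow> a * (I t \<omega> - I s \<omega>)"
      using I_lim
    proof eventually_elim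
      case (elim \<omega>)
      with st show ?case
        unfolding grid_scale grid_integral_clip[OF \<xi> st(2)] by (intro tendsto_intros) auto
    qed
    show "AE \<omega> in M. (\<lambda>n. grid_variation (N n) (clip_grid s t (\<tau> n)) (\<lambda>i \<omega>. a * clip_integrand s t (\<tau> n) (\<xi> n) i \<omega>) \<omega>)
        \<longlonglongrightarrow> a\<^sup>2 * (LBINT u:{s..t}. (H u \<omega>)\<^sup>2)"
      using h_lim H2 AE_space
    proof eventually_elim
      case (elim \<omega>)
      let ?h = "\<lambda>n u. indicator {s..t} u * simple_process (N n) (\<tau> n) (\<xi> n) u \<omega>" and ?H = "\<lambda>u. indicator {s..t} u * H u \<omega>"
      have fin: "(\<integral>\<^sup>+ u\<in>{0..t}. ennreal ((H u \<omega>)\<^sup>2) \<partial>lborel) < \<infinity>" using elim(2) \<open>0 \<le> t\<close> by simp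
      have "(\<lambda>n. \<integral>u. (?h n u)\<^sup>2 \<partial>lborel) \<longlonglongrightarrow> (\<integral>u. (?H u)\<^sup>2 \<partial>lborel)"
      proof (rule integral_square_limit)
        show "?h n \<in> borel_measurable lborel" for n
          unfolding simple_process_def
          by (intro borel_measurable_times borel_measurable_sum) auto
        show "?H \<in> borel_measurable lborel"
          using ito_integrand_measurable[OF F H st(1) elim(3)] by simp
        show "integrable lborel (\<lambda>u. (?h n u)\<^sup>2)" for n
          using has_bochner_integral_simple_process_square[OF \<xi> st(2)] by (rule integrable.intros)
        show "integrable lborel (\<lambda>u. (?H u)\<^sup>2)"
          by (rule ito_integrand_square_integrable[OF F H elim(3) fin st(1)]) simp
        have "(\<integral>\<^sup>+u. ennreal ((?h n u - ?H u)\<^sup>2) \<partial>lborel)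
            \<le> (\<integral>\<^sup>+ u\<in>{0..t}. ennreal ((simple_process (N n) (\<tau> n) (\<xi> n) u \<omega> - H u \<omega>)\<^sup>2) \<partial>lborel)" for n
          using st by (intro nn_integral_mono) (auto split: split_indicator)
        then show "(\<lambda>n. \<integral>\<^sup>+u. ennreal ((?h n u - ?H u)\<^sup>2) \<partial>lborel) \<longlonglongrightarrow> 0"
          by (intro tendsto_sandwich[OF _ _ tendsto_const elim(1)]) auto
      qed
      moreover have "(\<integral>u. (?h n u)\<^sup>2 \<partial>lborel)
          = grid_variation (N n) (clip_grid s t (\<tau> n)) (clip_integrand s t (\<tau> n) (\<xi> n)) \<omega>" for n
        using has_bochner_integral_simple_process_square[OF \<xi> st(2)] by (rule has_bochner_integral_integral_eq)
      ultimately show ?case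
        unfolding grid_scale ito_integrand_square_integrable(3)[OF F H elim(3) fin st(1) order_refl]
        by (intro tendsto_mult tendsto_const) simp
    qed
  qed
qed

text \<open>The definition of the integral does not state an initial value; it is inherited from the
  elementary integrals, which vanish at time 0 because no grid point is negative.\<close>

lemma ito_integral_at_0:
  assumes F: "filtered_prob_space M F" and B: "brownian_motion M F B" and I: "ito_integral M F B H I"
  shows "AE \<omega> in M. I 0 \<omega> = 0"
proof -
  obtain N \<tau> \<xi> where \<xi>: "\<And>n. simple_integrand M F (N n) (\<tau> n) (\<xi> n)"
    and I_lim: "AE \<omega> in M. \<forall>u\<in>{0..0}. (\<lambda>n. simple_integral (N n) (\<tau> n) (\<xi> n) B u \<omega>) \<longlonglongrightarrow> I u \<omega>"
    by (rule ito_integral_AE_approximation[OF F B I order_refl]) (rule that)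
  have zero: "simple_integral (N n) (\<tau> n) (\<xi> n) B 0 \<omega> = 0" for n \<omega>
    using simple_integrand_grid_nonneg[OF \<xi>[of n]] by (auto simp: simple_integral_def min_def intro!: sum.neutral)
  show ?thesis
    using I_lim by eventually_elim (simp add: zero LIMSEQ_const_iff)
qed

section \<open>Subgaussian bounds for integrals of bounded integrands\<close>

text \<open>Linearises a square in the exponent, by reading the right-hand side as the moment
  generating function at \<open>x\<close> of the centred normal law with variance
  \<open>2 * c\<close>.\<close>

lemma exp_square_gaussian_mixture:
  fixes x c :: real
  assumes "0 < c"
  shows "(\<integral>\<^sup>+a. ennreal (normal_density 0 (sqrt (2 * c)) a) * ennreal (exp (a * x)) \<partial>lborel) = ennreal (exp (c * x\<^sup>2))"
proof -
  have "(\<integral>\<^sup>+a. ennreal (normal_density 0 (sqrt (2 * c)) a) * ennreal (exp (a * x)) \<partial>lborel)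
      = (\<integral>\<^sup>+a. ennreal (exp (c * x\<^sup>2)) *
          (ennreal (normal_density 0 (sqrt (2 * c)) a) * ennreal (exp (x * a - x\<^sup>2 * (2 * c) / 2))) \<partial>lborel)"
  proof (rule nn_integral_cong)
    fix a :: real
    have "exp (a * x) = exp (c * x\<^sup>2) * exp (x * a - x\<^sup>2 * (2 * c) / 2)"
      by (simp add: mult_exp_exp algebra_simps)
    then show "ennreal (normal_density 0 (sqrt (2 * c)) a) * ennreal (exp (a * x))
      = ennreal (exp (c * x\<^sup>2)) * (ennreal (normal_density 0 (sqrt (2 * c)) a) * ennreal (exp (x * a - x\<^sup>2 * (2 * c) / 2)))"
      by (simp add: ennreal_mult' mult_ac)
  qed
  also have "\<dots> = ennreal (exp (c * x\<^sup>2))"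
    using assms by (subst nn_integral_cmult) (simp_all add: nn_integral_normal_density_exp[of "2 * c" x, simplified])
  finally show ?thesis .
qed

text \<open>Averaging the assumed bounds over a Gaussian \<open>a\<close> leaves, after Tonelli, a
  Gaussian integral that converges because \<open>c * K\<close> is small; no knowledge of the law of
  \<open>X\<close> beyond these bounds enters.\<close>

lemma (in prob_space) nn_integral_exp_square_subgaussian:
  assumes X[measurable]: "X \<in> borel_measurable M"
    and mgf: "\<And>a. (\<integral>\<^sup>+\<omega>. ennreal (exp (a * X \<omega>)) \<partial>M) \<le> ennreal (exp (a\<^sup>2 * K / 2))"
    and c: "0 < c" "4 * c * K \<le> 1"
  shows "(\<integral>\<^sup>+\<omega>. ennreal (exp (c * (X \<omega>)\<^sup>2)) \<partial>M) \<le> ennreal (sqrt 2)"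
proof -
  interpret pair_sigma_finite M lborel ..
  let ?n = "\<lambda>v a. normal_density 0 (sqrt v) a"
  \<comment> \<open>The hypothesis gives \<open>K / 2 \<le> 1 / (8 c)\<close>, so at most half of
    the exponent \<open>a\<^sup>2 / (4 c)\<close> is lost. What remains is the exponent for variance
    \<open>4 c\<close>, and \<open>sqrt 2\<close> is the ratio of the normalising constants.\<close>
  have dens: "?n (2 * c) a * exp (a\<^sup>2 * K / 2) \<le> sqrt 2 * ?n (4 * c) a" for a
  proof -
    have "a\<^sup>2 * (4 * c * K) \<le> a\<^sup>2 * 1"
      by (intro mult_left_mono c) simp
    then have "- a\<^sup>2 / (4 * c) + a\<^sup>2 * K / 2 \<le> - a\<^sup>2 / (8 * c)"
      using c(1) by (simp add: field_simps)
    then have "1 / sqrt (4 * pi * c) * exp (- a\<^sup>2 / (4 * c) + a\<^sup>2 * K / 2) \<le> 1 / sqrt (4 * pi * c) * exp (- a\<^sup>2 / (8 * c))"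
      using c(1) by (intro mult_left_mono) simp_all
    moreover have "?n (2 * c) a * exp (a\<^sup>2 * K / 2) = 1 / sqrt (4 * pi * c) * exp (- a\<^sup>2 / (4 * c) + a\<^sup>2 * K / 2)"
      using c(1) by (simp add: normal_density_def mult_exp_exp mult_ac)
    moreover have "sqrt 2 * ?n (4 * c) a = 1 / sqrt (4 * pi * c) * exp (- a\<^sup>2 / (8 * c))"
    proof -
      have "sqrt (8 * pi * c) = sqrt 2 * sqrt (4 * pi * c)"
        by (simp add: real_sqrt_mult[symmetric])
      then show ?thesis
        using c(1) by (simp add: normal_density_def mult_ac)
    qed
    ultimately show ?thesis by simp
  qed
  have "(\<integral>\<^sup>+\<omega>. ennreal (exp (c * (X \<omega>)\<^sup>2)) \<partial>M)
      = (\<integral>\<^sup>+\<omega>. (\<integral>\<^sup>+a. ennreal (?n (2 * c) a) * ennreal (exp (a * X \<omega>)) \<partial>lborel) \<partial>M)"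
    by (simp add: exp_square_gaussian_mixture[OF c(1)])
  also have "\<dots> = (\<integral>\<^sup>+a. (\<integral>\<^sup>+\<omega>. ennreal (?n (2 * c) a) * ennreal (exp (a * X \<omega>)) \<partial>M) \<partial>lborel)"
    by (rule Fubini'[symmetric]) measurable
  also have "\<dots> \<le> (\<integral>\<^sup>+a. ennreal (sqrt 2) * ennreal (?n (4 * c) a) \<partial>lborel)"
  proof (rule nn_integral_mono)
    fix a :: real
    have "(\<integral>\<^sup>+\<omega>. ennreal (?n (2 * c) a) * ennreal (exp (a * X \<omega>)) \<partial>M)
        = ennreal (?n (2 * c) a) * (\<integral>\<^sup>+\<omega>. ennreal (exp (a * X \<omega>)) \<partial>M)"
      by (rule nn_integral_cmult) measurable
    also have "\<dots> \<le> ennreal (?n (2 * c) a) * ennreal (exp (a\<^sup>2 * K / 2))"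
      by (intro mult_left_mono mgf) simp
    also have "\<dots> = ennreal (?n (2 * c) a * exp (a\<^sup>2 * K / 2))"
      by (simp add: ennreal_mult')
    also have "\<dots> \<le> ennreal (sqrt 2 * ?n (4 * c) a)"
      by (rule ennreal_leI[OF dens])
    also have "\<dots> = ennreal (sqrt 2) * ennreal (?n (4 * c) a)"
      by (simp add: ennreal_mult')
    finally show "(\<integral>\<^sup>+\<omega>. ennreal (?n (2 * c) a) * ennreal (exp (a * X \<omega>)) \<partial>M) \<le> ennreal (sqrt 2) * ennreal (?n (4 * c) a)" .
  qed
  also have "\<dots> = ennreal (sqrt 2)"
    using nn_integral_normal_density_exp[of "4 * c" 0] c(1) by (simp add: nn_integral_cmult)
  finally show ?thesis .
qed

text \<open>A deterministic bound on the variation makes the moment hypothesis of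
  \<open>ito_integral_exponential\<close> automatic; dropping the compensator then costs at most the
  factor on the right.\<close>

lemma ito_integral_mgf:
  assumes F: "filtered_prob_space M F" and B: "brownian_motion M F B" and I: "ito_integral M F B H I"
    and t: "0 \<le> t" and K: "\<And>\<omega>. \<omega> \<in> space M \<Longrightarrow> (LBINT u:{0..t}. (H u \<omega>)\<^sup>2) \<le> K"
  shows "(\<integral>\<^sup>+\<omega>. ennreal (exp (a * I t \<omega>)) \<partial>M) \<le> ennreal (exp (a\<^sup>2 * K / 2))"
proof -
  interpret prob_space M by (rule filtered_prob_space_prob_space[OF F])
  let ?V = "\<lambda>\<omega>. LBINT u:{0..t}. (H u \<omega>)\<^sup>2"
  have H: "progressively_measurable F H" and I': "adapted F I"
    using I unfolding ito_integral_def by blast+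
  have [measurable]: "?V \<in> borel_measurable M"
    by (rule ito_variation_measurable[OF F H order_refl t])
  have [measurable]: "I u \<in> borel_measurable M" if "0 \<le> u" for u
    using I' that by (intro filtered_measurable_M[OF F, of "I u" u]) (simp add: adapted_def)
  have [measurable]: "I t \<in> borel_measurable M" "I 0 \<in> borel_measurable M"
    using t by simp_all
  have V_le: "a\<^sup>2 * ?V \<omega> \<le> a\<^sup>2 * K" if "\<omega> \<in> space M" for \<omega>
    using K[OF that] by (intro mult_left_mono) simp_all
  have sp: "space M \<in> sets (F 0)"
    using filtered_prob_space_subalgebra[OF F, of 0] sets.top[of "F 0"] by (simp add: subalgebra_def)
  have "(\<integral>\<^sup>+\<omega>. ennreal (exp (6 * (a\<^sup>2 * ?V \<omega>))) \<partial>M) \<le> (\<integral>\<^sup>+\<omega>. ennreal (exp (6 * (a\<^sup>2 * K))) \<partial>M)"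
    using V_le by (intro nn_integral_mono ennreal_leI) simp
  also have "\<dots> < \<infinity>"
    by (simp add: emeasure_space_1)
  finally have one: "(\<integral>\<^sup>+\<omega>. indicator (space M) \<omega> * ennreal (exp (a * (I t \<omega> - I 0 \<omega>) - a\<^sup>2 * ?V \<omega> / 2)) \<partial>M) = 1"
    using ito_integral_exponential[OF F B I order_refl t sp] emeasure_space_1 by simp
  have "(\<integral>\<^sup>+\<omega>. ennreal (exp (a * I t \<omega>)) \<partial>M)
      \<le> (\<integral>\<^sup>+\<omega>. ennreal (exp (a\<^sup>2 * K / 2)) * (indicator (space M) \<omega> * ennreal (exp (a * (I t \<omega> - I 0 \<omega>) - a\<^sup>2 * ?V \<omega> / 2))) \<partial>M)"
  proof (rule nn_integral_mono_AE)
    show "AE \<omega> in M. ennreal (exp (a * I t \<omega>)) \<le>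
        ennreal (exp (a\<^sup>2 * K / 2)) * (indicator (space M) \<omega> * ennreal (exp (a * (I t \<omega> - I 0 \<omega>) - a\<^sup>2 * ?V \<omega> / 2)))"
      using ito_integral_at_0[OF F B I] AE_space
    proof eventually_elim
      case (elim \<omega>)
      have "exp (a * I t \<omega>) \<le> exp (a\<^sup>2 * K / 2) * exp (a * (I t \<omega> - I 0 \<omega>) - a\<^sup>2 * ?V \<omega> / 2)"
        using elim V_le[OF elim(2)] by (simp add: mult_exp_exp)
      then show ?case
        using elim(2) by (simp add: ennreal_mult'[symmetric] ennreal_leI)
    qed
  qed
  also have "\<dots> = ennreal (exp (a\<^sup>2 * K / 2)) * 1"
    unfolding one[symmetric] by (rule nn_integral_cmult) measurable
  finally show ?thesis by simp
qed

text \<open>Rounding time down to multiples of \<open>1 / (n + 1)\<close> leaves countably many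
  times, so the rounded process is jointly measurable, and path continuity gives the limit.
  \<open>max 0\<close> keeps times where adaptedness and continuity are known.\<close>

lemma continuous_adapted_measurable:
  assumes F: "filtered_prob_space M F" and X: "adapted F X" and cont: "continuous_paths M X"
  shows "(\<lambda>(\<omega>, u). X (max 0 u) \<omega> :: real) \<in> borel_measurable (M \<Otimes>\<^sub>M borel)"
proof (rule borel_measurable_LIMSEQ_real)
  let ?g = "\<lambda>n u. max 0 (real_of_int \<lfloor>real (Suc n) * u\<rfloor> / real (Suc n))"
  show "(\<lambda>(\<omega>, u). X (?g n u) \<omega>) \<in> borel_measurable (M \<Otimes>\<^sub>M borel)" for n
  proof -
    have "(\<lambda>z. X (?g n (snd z)) (fst z)) \<in> borel_measurable (M \<Otimes>\<^sub>M borel)"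
    proof (rule measurable_compose_countable[where
          f="\<lambda>i z. X (max 0 (real_of_int i / real (Suc n))) (fst z)" and g="\<lambda>z. \<lfloor>real (Suc n) * snd z\<rfloor>"])
      show "(\<lambda>z. X (max 0 (real_of_int i / real (Suc n))) (fst z)) \<in> borel_measurable (M \<Otimes>\<^sub>M borel)" for i
        using X by (intro measurable_compose[OF measurable_fst]
            filtered_measurable_M[OF F, of _ "max 0 (real_of_int i / real (Suc n))"]) (simp add: adapted_def)
      show "(\<lambda>z. \<lfloor>real (Suc n) * snd z\<rfloor>) \<in> measurable (M \<Otimes>\<^sub>M borel) (count_space UNIV)"
        by measurable
    qed
    then show ?thesis by (simp add: case_prod_beta)
  qed
  fix z assume "z \<in> space (M \<Otimes>\<^sub>M (borel :: real measure))"
  then obtain \<omega> u where z: "z = (\<omega>, u)" and \<omega>: "\<omega> \<in> space M"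
    by (auto simp: space_pair_measure)
  have "(\<lambda>n. real_of_int \<lfloor>real (Suc n) * u\<rfloor> / real (Suc n)) \<longlonglongrightarrow> u"
  proof (rule tendsto_sandwich)
    have "u - 1 / real (Suc n) \<le> real_of_int \<lfloor>real (Suc n) * u\<rfloor> / real (Suc n)" for n
    proof -
      have "real (Suc n) * u - 1 \<le> real_of_int \<lfloor>real (Suc n) * u\<rfloor>" by linarith
      then have "(real (Suc n) * u - 1) / real (Suc n) \<le> real_of_int \<lfloor>real (Suc n) * u\<rfloor> / real (Suc n)"
        by (rule divide_right_mono) simp
      then show ?thesis by (simp add: diff_divide_distrib del: of_nat_Suc)
    qed
    then show "eventually (\<lambda>n. u - 1 / real (Suc n) \<le> real_of_int \<lfloor>real (Suc n) * u\<rfloor> / real (Suc n)) sequentially"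
      by simp
    have "real_of_int \<lfloor>real (Suc n) * u\<rfloor> / real (Suc n) \<le> u" for n
    proof -
      have "real_of_int \<lfloor>real (Suc n) * u\<rfloor> \<le> real (Suc n) * u" by simp
      then have "real_of_int \<lfloor>real (Suc n) * u\<rfloor> / real (Suc n) \<le> (real (Suc n) * u) / real (Suc n)"
        by (rule divide_right_mono) simp
      then show ?thesis by (simp del: of_nat_Suc)
    qed
    then show "eventually (\<lambda>n. real_of_int \<lfloor>real (Suc n) * u\<rfloor> / real (Suc n) \<le> u) sequentially"
      by simp
    have "(\<lambda>n. u - 1 / real (Suc n)) \<longlonglongrightarrow> u - 0"
      by (intro tendsto_diff tendsto_const LIMSEQ_Suc[OF lim_1_over_n])
    then show "(\<lambda>n. u - 1 / real (Suc n)) \<longlonglongrightarrow> u" by simp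
  qed simp
  then have "(\<lambda>n. ?g n u) \<longlonglongrightarrow> max 0 u"
    by (intro tendsto_max tendsto_const)
  then have "(\<lambda>n. X (?g n u) \<omega>) \<longlonglongrightarrow> X (max 0 u) \<omega>"
    using cont \<omega> by (intro continuous_on_tendsto_compose[of "{0..}" "\<lambda>t. X t \<omega>"]) (auto simp: continuous_paths_def)
  then show "(\<lambda>n. case z of (\<omega>, u) \<Rightarrow> X (?g n u) \<omega>) \<longlonglongrightarrow> (case z of (\<omega>, u) \<Rightarrow> X (max 0 u) \<omega>)"
    by (simp add: z)
qed

text \<open>Jensen's inequality for the uniform law on \<open>[s, t]\<close>.\<close>

lemma jensen_exp_interval:
  fixes f :: "real \<Rightarrow> real"
  assumes f: "continuous_on {s..t} f" and "s < t"
  shows "ennreal (exp (c * (LBINT u:{s..t}. f u)))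
    \<le> ennreal (1 / (t - s)) * (\<integral>\<^sup>+u\<in>{s..t}. ennreal (exp (c * (t - s) * f u)) \<partial>lborel)"
proof -
  let ?L = "t - s" and ?m = "c * (LBINT u:{s..t}. f u)"
  have fi: "set_integrable lborel {s..t} f"
    by (rule borel_integrable_atLeastAtMost'[OF f])
  have ei: "set_integrable lborel {s..t} (\<lambda>u. exp (c * ?L * f u))"
    by (intro borel_integrable_atLeastAtMost' continuous_intros f)
  have ci: "set_integrable lborel {s..t} (\<lambda>u. k)" for k :: real
    by (intro borel_integrable_atLeastAtMost' continuous_intros)
  \<comment> \<open>The integrand is the tangent of \<open>exp\<close> at \<open>?m\<close>,
    evaluated at \<open>c * ?L * f u\<close>. This argument has mean \<open>?m\<close>, so the
    deviation integrates to 0; and the tangent lies below \<open>exp\<close>.\<close>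
  have "?L * exp ?m = (LBINT u:{s..t}. exp ?m * (1 - ?m) + exp ?m * (c * ?L) * f u)"
  proof -
    have "(LBINT u:{s..t}. exp ?m * (1 - ?m) + exp ?m * (c * ?L) * f u)
        = exp ?m * (1 - ?m) * ?L + exp ?m * (c * ?L) * (LBINT u:{s..t}. f u)"
      using fi ci \<open>s < t\<close> by (simp add: set_integral_add set_lebesgue_integral_def[of lborel "{s..t}" "\<lambda>_. _"])
    then show ?thesis by (simp add: algebra_simps)
  qed
  also have "\<dots> \<le> (LBINT u:{s..t}. exp (c * ?L * f u))"
  proof (intro set_integral_mono ei)
    show "set_integrable lborel {s..t} (\<lambda>u. exp ?m * (1 - ?m) + exp ?m * (c * ?L) * f u)"
      using fi ci by (intro set_integral_add set_integrable_mult_right) auto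
    show "exp ?m * (1 - ?m) + exp ?m * (c * ?L) * f u \<le> exp (c * ?L * f u)" for u
    proof -
      have "exp ?m * (1 + (c * ?L * f u - ?m)) \<le> exp ?m * exp (c * ?L * f u - ?m)"
        by (intro mult_left_mono exp_ge_add_one_self) simp
      then show ?thesis by (simp add: mult_exp_exp algebra_simps)
    qed
  qed
  finally have "exp ?m \<le> 1 / ?L * (LBINT u:{s..t}. exp (c * ?L * f u))"
    using \<open>s < t\<close> by (simp add: field_simps)
  then have "ennreal (exp ?m) \<le> ennreal (1 / ?L) * ennreal (LBINT u:{s..t}. exp (c * ?L * f u))"
    using \<open>s < t\<close> by (subst ennreal_mult'[symmetric]) (simp_all add: ennreal_leI)
  also have "ennreal (LBINT u:{s..t}. exp (c * ?L * f u)) = (\<integral>\<^sup>+u\<in>{s..t}. ennreal (exp (c * ?L * f u)) \<partial>lborel)"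
  proof -
    have "ennreal (exp (c * ?L * f u)) * indicator {s..t} u = ennreal (indicator {s..t} u *\<^sub>R exp (c * ?L * f u))" for u
      by (simp split: split_indicator)
    then show ?thesis
      using ei unfolding set_integrable_def set_lebesgue_integral_def
      by (simp only:) (rule nn_integral_eq_integral[symmetric], simp_all)
  qed
  finally show ?thesis .
qed

text \<open>Jensen moves the time average outside the exponential, and Tonelli reduces to a single
  time, where the subgaussian bound applies with constant \<open>c * (t - s)\<close>. So a short
  interval admits a large \<open>c\<close>.\<close>

lemma ito_integral_exp_square_integral:
  assumes F: "filtered_prob_space M F" and B: "brownian_motion M F B" and I: "ito_integral M F B H I"
    and st: "0 \<le> s" "s \<le> t"
    and K: "\<And>\<omega> u. \<omega> \<in> space M \<Longrightarrow> u \<in> {0..t} \<Longrightarrow> (LBINT v:{0..u}. (H v \<omega>)\<^sup>2) \<le> K"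
    and c: "0 < c" "4 * c * (t - s) * K \<le> 1"
  shows "(\<integral>\<^sup>+\<omega>. ennreal (exp (c * (LBINT u:{s..t}. (I u \<omega>)\<^sup>2))) \<partial>M) \<le> ennreal (sqrt 2)"
proof -
  interpret prob_space M by (rule filtered_prob_space_prob_space[OF F])
  interpret pair_sigma_finite M lborel ..
  have I': "adapted F I" "continuous_paths M I"
    using I unfolding ito_integral_def by blast+
  show ?thesis
  proof (cases "s = t")
    case True
    have "(LBINT u:{s..t}. (I u \<omega>)\<^sup>2) = 0" for \<omega>
      unfolding True set_lebesgue_integral_def
      by (rule integral_eq_zero_AE) (use AE_lborel_singleton[of t] in eventually_elim, simp)
    then show ?thesis by (simp add: emeasure_space_1)
  next
    case False
    then have "s < t" using st by simp
    let ?L = "t - s"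
    have Im[measurable]: "I u \<in> borel_measurable M" if "0 \<le> u" for u
      using I' that by (intro filtered_measurable_M[OF F, of "I u" u]) (simp add: adapted_def)
    note [measurable] = continuous_adapted_measurable[OF F I', unfolded case_prod_beta]
    let ?f = "\<lambda>\<omega> u. ennreal (exp (c * ?L * (I (max 0 u) \<omega>)\<^sup>2)) * indicator {s..t} u"
    have eq: "ennreal (exp (c * ?L * (I u \<omega>)\<^sup>2)) * indicator {s..t} u = ?f \<omega> u" for \<omega> u
      using st by (simp add: max_def split: split_indicator)
    have meas: "case_prod ?f \<in> borel_measurable (M \<Otimes>\<^sub>M lborel)"
      unfolding case_prod_beta by measurable
    have "(\<integral>\<^sup>+\<omega>. ennreal (exp (c * (LBINT u:{s..t}. (I u \<omega>)\<^sup>2))) \<partial>M)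
        \<le> (\<integral>\<^sup>+\<omega>. ennreal (1 / ?L) * (\<integral>\<^sup>+u. ?f \<omega> u \<partial>lborel) \<partial>M)"
    proof (rule nn_integral_mono)
      fix \<omega> assume "\<omega> \<in> space M"
      then have "continuous_on {s..t} (\<lambda>u. (I u \<omega>)\<^sup>2)"
        using I'(2) st by (intro continuous_intros continuous_on_subset[where s="{0..}" and t="{s..t}"])
          (auto simp: continuous_paths_def)
      from jensen_exp_interval[OF this \<open>s < t\<close>, of c]
      show "ennreal (exp (c * (LBINT u:{s..t}. (I u \<omega>)\<^sup>2))) \<le> ennreal (1 / ?L) * (\<integral>\<^sup>+u. ?f \<omega> u \<partial>lborel)"
        unfolding eq .
    qed
    also have "\<dots> = ennreal (1 / ?L) * (\<integral>\<^sup>+\<omega>. (\<integral>\<^sup>+u. ?f \<omega> u \<partial>lborel) \<partial>M)"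
      by (rule nn_integral_cmult[OF lborel.borel_measurable_nn_integral[OF meas]])
    also have "(\<integral>\<^sup>+\<omega>. (\<integral>\<^sup>+u. ?f \<omega> u \<partial>lborel) \<partial>M) = (\<integral>\<^sup>+u. (\<integral>\<^sup>+\<omega>. ?f \<omega> u \<partial>M) \<partial>lborel)"
      by (rule Fubini'[OF meas, symmetric])
    also have "\<dots> \<le> (\<integral>\<^sup>+u. ennreal (sqrt 2) * indicator {s..t} u \<partial>lborel)"
    proof (rule nn_integral_mono)
      fix u :: real
      show "(\<integral>\<^sup>+\<omega>. ?f \<omega> u \<partial>M) \<le> ennreal (sqrt 2) * indicator {s..t} u"
      proof (cases "u \<in> {s..t}")
        case True
        then have u: "0 \<le> u" "max 0 u = u" using st by auto
        have "(\<integral>\<^sup>+\<omega>. ennreal (exp (c * ?L * (I u \<omega>)\<^sup>2)) \<partial>M) \<le> ennreal (sqrt 2)"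
        proof (rule nn_integral_exp_square_subgaussian[OF Im[OF u(1)]])
          show "(\<integral>\<^sup>+\<omega>. ennreal (exp (a * I u \<omega>)) \<partial>M) \<le> ennreal (exp (a\<^sup>2 * K / 2))" for a
            using K True u(1) by (intro ito_integral_mgf[OF F B I u(1)]) auto
          show "0 < c * ?L" "4 * (c * ?L) * K \<le> 1"
            using c \<open>s < t\<close> by (simp_all add: mult.assoc)
        qed
        then show ?thesis using True u by simp
      qed simp
    qed
    also have "\<dots> = ennreal (sqrt 2) * ennreal ?L"
      using \<open>s < t\<close> by (subst nn_integral_cmult_indicator) auto
    also have "ennreal (1 / ?L) * (ennreal (sqrt 2) * ennreal ?L) = ennreal (sqrt 2)"
      using \<open>s < t\<close> by (simp add: ennreal_mult'[symmetric])
    finally show ?thesis by (simp add: mult_left_mono)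
  qed
qed

section \<open>Exponential moments of the variance factor\<close>

text \<open>\<open>y\<close> is only continuous, but \<open>v = y - i\<close> is differentiable with
  \<open>v' = \<kappa> (\<theta> - v - i)\<close>. Comparison with \<open>m\<close>, whose
  derivative omits the restoring term, bounds \<open>v\<close> without the exponential factor of a
  Gronwall estimate.\<close>

lemma affine_integral_equation_bound:
  fixes y i :: "real \<Rightarrow> real"
  assumes y: "continuous_on {0..T} y" and i: "continuous_on {0..T} i"
    and nonneg: "0 \<le> T" "0 \<le> \<kappa>" "0 \<le> \<theta>"
    and eq: "\<And>u. u \<in> {0..T} \<Longrightarrow> y u = x + (LBINT v:{0..u}. \<kappa> * (\<theta> - y v)) + i u"
  shows "\<bar>y T\<bar> \<le> \<bar>x\<bar> + \<kappa> * \<theta> * T + \<kappa> * (LBINT v:{0..T}. \<bar>i v\<bar>) + \<bar>i T\<bar>"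
proof -
  define v where "v u = x + integral {0..u} (\<lambda>r. \<kappa> * (\<theta> - y r))" for u
  define m where "m u = \<bar>x\<bar> + integral {0..u} (\<lambda>r. \<kappa> * \<theta> + \<kappa> * \<bar>i r\<bar>)" for u
  have c1: "continuous_on {0..T} (\<lambda>r. \<kappa> * (\<theta> - y r))" and c2: "continuous_on {0..T} (\<lambda>r. \<kappa> * \<theta> + \<kappa> * \<bar>i r\<bar>)"
    by (intro continuous_intros y i)+
  have dv: "(v has_real_derivative \<kappa> * (\<theta> - y u)) (at u within {0..T})" if "u \<in> {0..T}" for u
    unfolding v_def[abs_def]
    by (rule derivative_eq_intros integral_has_real_derivative[OF c1 that] refl)+ simp
  have dm: "(m has_real_derivative \<kappa> * \<theta> + \<kappa> * \<bar>i u\<bar>) (at u within {0..T})" if "u \<in> {0..T}" for u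
    unfolding m_def[abs_def]
    by (rule derivative_eq_intros integral_has_real_derivative[OF c2 that] refl)+ simp
  have yv: "y u = v u + i u" if "u \<in> {0..T}" for u
  proof -
    have "set_integrable lborel {0..u} (\<lambda>r. \<kappa> * (\<theta> - y r))"
      by (rule borel_integrable_atLeastAtMost'[OF continuous_on_subset[OF c1]]) (use that in auto)
    then show ?thesis
      using eq[OF that] by (simp only: v_def set_borel_integral_eq_integral(2))
  qed
  \<comment> \<open>Stated for all \<open>u\<close>, where integrability may fail; the integral is
    then 0 by convention and the bound still holds.\<close>
  have m_nonneg: "0 \<le> m u" for u
  proof -
    have "0 \<le> integral {0..u} (\<lambda>r. \<kappa> * \<theta> + \<kappa> * \<bar>i r\<bar>)"
      using nonneg by (cases "(\<lambda>r. \<kappa> * \<theta> + \<kappa> * \<bar>i r\<bar>) integrable_on {0..u}")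
        (auto intro!: integral_nonneg simp: not_integrable_integral)
    then show ?thesis by (simp add: m_def)
  qed
  \<comment> \<open>The two signs give the upper and the lower bound for \<open>v T\<close> by one
    argument.\<close>
  have le: "\<sigma> * v T \<le> m T" if \<sigma>: "\<sigma> = 1 \<or> \<sigma> = -1" for \<sigma> :: real
  proof -
    \<comment> \<open>The integrating factor removes the mean reversion, leaving a nonnegative derivative.\<close>
    define g where "g u = exp (\<kappa> * u) * (m u - \<sigma> * v u)" for u
    have dg: "(g has_real_derivative exp (\<kappa> * u) * (\<kappa> * m u + (\<kappa> * \<theta> - \<sigma> * (\<kappa> * \<theta>)) + (\<kappa> * \<bar>i u\<bar> + \<sigma> * (\<kappa> * i u))))
        (at u within {0..T})" if "u \<in> {0..T}" for u
      unfolding g_def[abs_def]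
      by (rule derivative_eq_intros dv[OF that] dm[OF that] refl)+ (simp add: yv[OF that] algebra_simps)
    have "g 0 \<le> g T"
    proof (rule DERIV_nonneg_imp_increasing_open[OF nonneg(1)])
      show "continuous_on {0..T} g"
        using dg by (intro DERIV_continuous_on) blast
      show "\<exists>z. DERIV g u :> z \<and> 0 \<le> z" if u: "0 < u" "u < T" for u
      proof (intro exI conjI)
        show "DERIV g u :> exp (\<kappa> * u) * (\<kappa> * m u + (\<kappa> * \<theta> - \<sigma> * (\<kappa> * \<theta>)) + (\<kappa> * \<bar>i u\<bar> + \<sigma> * (\<kappa> * i u)))"
          using dg[of u] u by (simp add: at_within_Icc_at)
        have "0 \<le> \<kappa> * m u" using nonneg m_nonneg by simp
        moreover have "0 \<le> \<kappa> * \<theta> - \<sigma> * (\<kappa> * \<theta>)" using \<sigma> nonneg by auto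
        moreover have "0 \<le> \<kappa> * \<bar>i u\<bar> + \<sigma> * (\<kappa> * i u)"
        proof -
          have "0 \<le> \<kappa> * (\<bar>i u\<bar> + \<sigma> * i u)" using \<sigma> nonneg by (intro mult_nonneg_nonneg) auto
          then show ?thesis by (simp add: algebra_simps)
        qed
        ultimately show "0 \<le> exp (\<kappa> * u) * (\<kappa> * m u + (\<kappa> * \<theta> - \<sigma> * (\<kappa> * \<theta>)) + (\<kappa> * \<bar>i u\<bar> + \<sigma> * (\<kappa> * i u)))"
          by (intro mult_nonneg_nonneg[OF exp_ge_zero]) linarith
      qed
    qed
    moreover have "0 \<le> g 0" using \<sigma> by (auto simp: g_def m_def v_def)
    ultimately have "0 \<le> g T" by simp
    then show ?thesis by (simp add: g_def zero_le_mult_iff)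
  qed
  have "m T = \<bar>x\<bar> + \<kappa> * \<theta> * T + \<kappa> * (LBINT v:{0..T}. \<bar>i v\<bar>)"
  proof -
    have "continuous_on {0..T} (\<lambda>r. \<bar>i r\<bar>)" by (intro continuous_intros i)
    then have "set_integrable lborel {0..T} (\<lambda>r. \<bar>i r\<bar>)" "(\<lambda>r. \<bar>i r\<bar>) integrable_on {0..T}"
      by (auto intro: borel_integrable_atLeastAtMost' integrable_continuous_real)
    moreover have "integral {0..T} (\<lambda>r. \<kappa> * \<theta> + \<kappa> * \<bar>i r\<bar>)
        = integral {0..T} (\<lambda>r. \<kappa> * \<theta>) + integral {0..T} (\<lambda>r. \<kappa> * \<bar>i r\<bar>)"
      by (intro Henstock_Kurzweil_Integration.integral_add integrable_continuous_real continuous_intros i)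
    ultimately show ?thesis
      using nonneg by (simp add: m_def set_borel_integral_eq_integral(2) mult_ac)
  qed
  moreover have "\<bar>v T\<bar> \<le> m T" using le[of 1] le[of "-1"] by simp
  moreover have "y T = v T + i T" using yv nonneg by simp
  ultimately show ?thesis by linarith
qed

text \<open>Strictly before \<zeta> the equation is one between real numbers and feeds
  \<open>affine_integral_equation_bound\<close>; from \<zeta> on the left side is 0. The integral in
  the bound runs to \<open>T\<close> and not to \<open>u\<close>, so that only the last term depends
  on \<open>u\<close>.\<close>

lemma sz_variance_bound:
  assumes sz: "sz_variance M F W \<kappa> \<theta> \<gamma> x\<^sub>0 Y \<zeta>" and nonneg: "0 \<le> \<kappa>" "0 \<le> \<theta>"
  obtains I where "ito_integral M F W (\<lambda>t \<omega>. \<gamma> * before \<zeta> t \<omega>) I"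
    and "AE \<omega> in M. \<forall>T. \<forall>u\<in>{0..T}. \<bar>real_of_ereal (Y u \<omega>) * before \<zeta> u \<omega>\<bar>
      \<le> \<bar>x\<^sub>0\<bar> + \<kappa> * \<theta> * T + \<kappa> * (LBINT v:{0..T}. \<bar>I v \<omega>\<bar>) + \<bar>I u \<omega>\<bar>"
proof -
  have \<zeta>: "\<zeta> = exit_time Y {-\<infinity><..<\<infinity>}" and Y: "continuous_paths M Y"
    using sz unfolding sz_variance_def by blast+
  from sz obtain I where I: "ito_integral M F W (\<lambda>t \<omega>. \<gamma> * before \<zeta> t \<omega>) I"
    and eq: "AE \<omega> in M. \<forall>t\<ge>0. ereal t < \<zeta> \<omega> \<longrightarrow>
           Y t \<omega> = ereal (x\<^sub>0 +
             (LBINT u:{0..t}. \<kappa> * (\<theta> - real_of_ereal (Y u \<omega>)) * before \<zeta> u \<omega>) + I t \<omega>)"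
    unfolding sz_variance_def by blast
  have I': "continuous_paths M I"
    using I unfolding ito_integral_def by blast
  have "AE \<omega> in M. \<forall>T. \<forall>u\<in>{0..T}. \<bar>real_of_ereal (Y u \<omega>) * before \<zeta> u \<omega>\<bar>
      \<le> \<bar>x\<^sub>0\<bar> + \<kappa> * \<theta> * T + \<kappa> * (LBINT v:{0..T}. \<bar>I v \<omega>\<bar>) + \<bar>I u \<omega>\<bar>"
    using eq AE_space
  proof eventually_elim
    case (elim \<omega>)
    have Ic: "continuous_on {0..} (\<lambda>u. I u \<omega>)" and Yc: "continuous_on {0..} (\<lambda>u. Y u \<omega>)"
      using I' Y elim(2) by (auto simp: continuous_paths_def)
    show ?case
    proof (intro allI ballI)
      fix T u :: real assume u: "u \<in> {0..T}"
      have abs_int: "set_integrable lborel {0..T} (\<lambda>v. \<bar>I v \<omega>\<bar>)"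
        by (intro borel_integrable_atLeastAtMost' continuous_intros continuous_on_subset[OF Ic]) auto
      have mono_int: "(LBINT v:{0..u}. \<bar>I v \<omega>\<bar>) \<le> (LBINT v:{0..T}. \<bar>I v \<omega>\<bar>)"
        unfolding set_lebesgue_integral_def
        by (rule integral_mono'[OF abs_int[unfolded set_integrable_def]]) (use u in \<open>auto split: split_indicator\<close>)
      show "\<bar>real_of_ereal (Y u \<omega>) * before \<zeta> u \<omega>\<bar>
          \<le> \<bar>x\<^sub>0\<bar> + \<kappa> * \<theta> * T + \<kappa> * (LBINT v:{0..T}. \<bar>I v \<omega>\<bar>) + \<bar>I u \<omega>\<bar>"
      proof (cases "ereal u < \<zeta> \<omega>")
        case True
        have less: "ereal v < \<zeta> \<omega>" if "v \<in> {0..u}" for v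
          using that by (intro le_less_trans[OF _ True]) simp
        have before: "before \<zeta> v \<omega> = 1" if "v \<in> {0..u}" for v
          using less[OF that] that by (simp add: before_def)
        \<comment> \<open>An infinite value at \<open>v\<close> is an exit from the state space,
          which would force \<open>\<zeta> \<omega> \<le> v\<close>.\<close>
        have fin: "\<bar>Y v \<omega>\<bar> \<noteq> \<infinity>" if "v \<in> {0..u}" for v
        proof
          assume "\<bar>Y v \<omega>\<bar> = \<infinity>"
          then have "Y v \<omega> \<notin> {-\<infinity><..<\<infinity>}" by auto
          then have "\<zeta> \<omega> \<le> ereal v"
            using that unfolding \<zeta> exit_time_def by (intro Inf_lower) auto
          with less[OF that] show False by simp
        qed
        let ?y = "\<lambda>v. real_of_ereal (Y v \<omega>)"
        have "\<bar>?y u\<bar> \<le> \<bar>x\<^sub>0\<bar> + \<kappa> * \<theta> * u + \<kappa> * (LBINT v:{0..u}. \<bar>I v \<omega>\<bar>) + \<bar>I u \<omega>\<bar>"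
        proof (rule affine_integral_equation_bound)
          have "continuous_on {0..u} (\<lambda>v. Y v \<omega>)"
            by (rule continuous_on_subset[OF Yc]) auto
          then show "continuous_on {0..u} ?y"
            using fin continuous_on_iff_real[of "{0..u}" "\<lambda>v. Y v \<omega>"] by (simp add: o_def)
          show "continuous_on {0..u} (\<lambda>u. I u \<omega>)"
            by (rule continuous_on_subset[OF Ic]) auto
          show "?y v = x\<^sub>0 + (LBINT r:{0..v}. \<kappa> * (\<theta> - ?y r)) + I v \<omega>" if v: "v \<in> {0..u}" for v
          proof -
            have "(LBINT r:{0..v}. \<kappa> * (\<theta> - ?y r) * before \<zeta> r \<omega>) = (LBINT r:{0..v}. \<kappa> * (\<theta> - ?y r))"
              using v before by (intro set_lebesgue_integral_cong) auto
            then show ?thesis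
              using elim(1) less[OF v] v by simp
          qed
        qed (use u nonneg in auto)
        also have "\<dots> \<le> \<bar>x\<^sub>0\<bar> + \<kappa> * \<theta> * T + \<kappa> * (LBINT v:{0..T}. \<bar>I v \<omega>\<bar>) + \<bar>I u \<omega>\<bar>"
          using u nonneg mono_int by (intro add_mono mult_left_mono order_refl) auto
        finally show ?thesis using before u by simp
      next
        case False
        have "0 \<le> (LBINT v:{0..T}. \<bar>I v \<omega>\<bar>)"
          unfolding set_lebesgue_integral_def by (intro Bochner_Integration.integral_nonneg) simp
        then have "0 \<le> \<bar>x\<^sub>0\<bar> + \<kappa> * \<theta> * T + \<kappa> * (LBINT v:{0..T}. \<bar>I v \<omega>\<bar>) + \<bar>I u \<omega>\<bar>"
          using u nonneg by (intro add_nonneg_nonneg mult_nonneg_nonneg) auto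
        then show ?thesis using False by (simp add: before_def)
      qed
    qed
  qed
  with I show thesis by (rule that)
qed

text \<open>Nonnegativity of a variance: expand the integral of
  \<open>(|f| - m / T)\<^sup>2\<close>, where \<open>m / T\<close> is the mean of
  \<open>|f|\<close>.\<close>

lemma set_integral_cauchy_schwarz:
  fixes f :: "real \<Rightarrow> real"
  assumes f: "continuous_on {0..T} f" and "0 < T"
  shows "(LBINT v:{0..T}. \<bar>f v\<bar>)\<^sup>2 \<le> T * (LBINT v:{0..T}. (f v)\<^sup>2)"
proof -
  define m where "m = (LBINT v:{0..T}. \<bar>f v\<bar>)"
  have i1: "set_integrable lborel {0..T} (\<lambda>v. \<bar>f v\<bar>)" and i2: "set_integrable lborel {0..T} (\<lambda>v. (f v)\<^sup>2)"
    and i3: "set_integrable lborel {0..T} (\<lambda>v. k)" for k :: real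
    by (intro borel_integrable_atLeastAtMost' continuous_intros f)+
  have "0 \<le> (LBINT v:{0..T}. (\<bar>f v\<bar> - m / T)\<^sup>2)"
    unfolding set_lebesgue_integral_def by (intro Bochner_Integration.integral_nonneg) simp
  also have "\<dots> = (LBINT v:{0..T}. (f v)\<^sup>2 + (- (2 * m / T)) * \<bar>f v\<bar> + (m / T)\<^sup>2)"
    by (rule arg_cong[where f="set_lebesgue_integral lborel {0..T}"]) (simp add: fun_eq_iff power2_diff)
  also have "\<dots> = (LBINT v:{0..T}. (f v)\<^sup>2) + (- (2 * m / T)) * m + (m / T)\<^sup>2 * T"
    using \<open>0 < T\<close> i1 i2 i3[of "(m / T)\<^sup>2"] unfolding m_def
    by (subst set_integral_add(2))
       (auto simp: set_integral_add set_lebesgue_integral_def[of lborel "{0..T}" "\<lambda>_. _"] simp del: mult_minus_left)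
  finally have "m\<^sup>2 / T \<le> (LBINT v:{0..T}. (f v)\<^sup>2)"
    using \<open>0 < T\<close> by (simp add: power2_eq_square)
  then show ?thesis
    using \<open>0 < T\<close> by (simp add: m_def field_simps)
qed

text \<open>In the pathwise bound all terms but the last are constant in \<open>u\<close>, so
  integrating their squares over the window multiplies them by its length. This makes the noise
  accumulated over all of \<open>[0, T]\<close> harmless, while the noise inside the window is
  controlled by Jensen on a short interval. Neither estimate depends on the position of the window,
  so one \<delta> serves the whole horizon.\<close>

lemma sz_exp_variation_finite:
  assumes F: "filtered_prob_space M F" and W: "brownian_motion M F W"
    and sz: "sz_variance M F W \<kappa> \<theta> \<gamma> x\<^sub>0 Y \<zeta>" and pos: "0 < \<kappa>" "0 < \<theta>" "0 < \<gamma>" and "0 < T"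
  obtains \<delta> where "0 < \<delta>"
    and "\<And>s t. 0 \<le> s \<Longrightarrow> s \<le> t \<Longrightarrow> t \<le> T \<Longrightarrow> t - s \<le> \<delta> \<Longrightarrow>
      (\<integral>\<^sup>+\<omega>. ennreal (exp (6 * (LBINT u:{s..t}. (real_of_ereal (Y u \<omega>) * before \<zeta> u \<omega>)\<^sup>2))) \<partial>M) < \<infinity>"
proof -
  interpret prob_space M by (rule filtered_prob_space_prob_space[OF F])
  obtain I where I: "ito_integral M F W (\<lambda>t \<omega>. \<gamma> * before \<zeta> t \<omega>) I"
    and bound: "AE \<omega> in M. \<forall>T. \<forall>u\<in>{0..T}. \<bar>real_of_ereal (Y u \<omega>) * before \<zeta> u \<omega>\<bar>
      \<le> \<bar>x\<^sub>0\<bar> + \<kappa> * \<theta> * T + \<kappa> * (LBINT v:{0..T}. \<bar>I v \<omega>\<bar>) + \<bar>I u \<omega>\<bar>"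
    by (rule sz_variance_bound[OF sz less_imp_le[OF pos(1)] less_imp_le[OF pos(2)]]) (rule that)
  have I': "adapted F I" "continuous_paths M I"
    using I unfolding ito_integral_def by blast+
  define K where "K = \<gamma>\<^sup>2 * T"
  define C where "C = \<bar>x\<^sub>0\<bar> + \<kappa> * \<theta> * T"
  \<comment> \<open>The first entry is the condition \<open>4 * 36 * \<delta> * K \<le> 1\<close>
    for the noise inside the window, the second is \<open>4 * c * T * K \<le> 1\<close> with
    \<open>c = 36 \<kappa>\<^sup>2 T \<delta>\<close> for the noise over
    \<open>[0, T]\<close>.\<close>
  define \<delta> where "\<delta> = min (1 / (144 * K)) (1 / (144 * \<kappa>\<^sup>2 * T\<^sup>2 * K))"
  have "0 < K" using pos \<open>0 < T\<close> by (simp add: K_def)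
  then have "0 < \<delta>" using pos \<open>0 < T\<close> by (simp add: \<delta>_def)
  have K: "(LBINT v:{0..u}. (\<gamma> * before \<zeta> v \<omega>)\<^sup>2) \<le> K" if "u \<in> {0..T}" for u \<omega>
  proof -
    have "(LBINT v:{0..u}. (\<gamma> * before \<zeta> v \<omega>)\<^sup>2) \<le> (LBINT v:{0..u}. \<gamma>\<^sup>2)"
      unfolding set_lebesgue_integral_def
    proof (rule integral_mono')
      show "integrable lborel (\<lambda>v. indicator {0..u} v *\<^sub>R \<gamma>\<^sup>2)"
        using borel_integrable_atLeastAtMost'[of 0 u "\<lambda>_. \<gamma>\<^sup>2"] by (simp add: set_integrable_def)
      show "indicator {0..u} v *\<^sub>R (\<gamma> * before \<zeta> v \<omega>)\<^sup>2 \<le> indicator {0..u} v *\<^sub>R \<gamma>\<^sup>2" for v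
        by (auto simp: before_def power_mult_distrib split: split_indicator)
    qed simp
    also have "\<dots> = \<gamma>\<^sup>2 * u"
      using that by (simp add: set_lebesgue_integral_def)
    also have "\<dots> \<le> K" using that by (simp add: K_def mult_left_mono)
    finally show ?thesis .
  qed
  have main: "(\<integral>\<^sup>+\<omega>. ennreal (exp (6 * (LBINT u:{s..t}. (real_of_ereal (Y u \<omega>) * before \<zeta> u \<omega>)\<^sup>2))) \<partial>M) < \<infinity>"
    if st: "0 \<le> s" "s \<le> t" "t \<le> T" "t - s \<le> \<delta>" for s t
  proof -
    let ?A = "\<lambda>\<omega>. LBINT u:{s..t}. (I u \<omega>)\<^sup>2" and ?B = "\<lambda>\<omega>. LBINT u:{0..T}. (I u \<omega>)\<^sup>2"
    \<comment> \<open>Squaring a sum of three terms costs 3, so 6 becomes 18; separating the two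
      noise exponentials by AM-GM doubles this to 36. In \<open>c\<close> the factor
      \<open>T\<close> comes from Cauchy-Schwarz and \<delta> from the window length.\<close>
    define c where "c = 36 * \<kappa>\<^sup>2 * T * \<delta>"
    define D where "D = ennreal (exp (18 * C\<^sup>2 * T))"
    have "0 < c" using pos \<open>0 < T\<close> \<open>0 < \<delta>\<close> by (simp add: c_def)
    have EA: "(\<integral>\<^sup>+\<omega>. ennreal (exp (36 * ?A \<omega>)) \<partial>M) \<le> ennreal (sqrt 2)"
    proof (rule ito_integral_exp_square_integral[OF F W I st(1,2)])
      have "t - s \<le> 1 / (144 * K)" using st(4) by (simp add: \<delta>_def)
      then have "(t - s) * (144 * K) \<le> 1" using \<open>0 < K\<close> by (simp add: pos_le_divide_eq)
      then show "4 * 36 * (t - s) * K \<le> 1" by (simp add: algebra_simps)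
    qed (use K st in auto)
    have EB: "(\<integral>\<^sup>+\<omega>. ennreal (exp (c * ?B \<omega>)) \<partial>M) \<le> ennreal (sqrt 2)"
    proof (rule ito_integral_exp_square_integral[OF F W I order_refl less_imp_le[OF \<open>0 < T\<close>]])
      have "\<delta> \<le> 1 / (144 * \<kappa>\<^sup>2 * T\<^sup>2 * K)" by (simp add: \<delta>_def)
      then have "\<delta> * (144 * \<kappa>\<^sup>2 * T\<^sup>2 * K) \<le> 1"
        using \<open>0 < K\<close> pos \<open>0 < T\<close> by (simp add: pos_le_divide_eq)
      then show "4 * c * (T - 0) * K \<le> 1" by (simp add: c_def power2_eq_square algebra_simps)
    qed (use K \<open>0 < c\<close> in auto)
    have "(\<integral>\<^sup>+\<omega>. ennreal (exp (6 * (LBINT u:{s..t}. (real_of_ereal (Y u \<omega>) * before \<zeta> u \<omega>)\<^sup>2))) \<partial>M)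
        \<le> (\<integral>\<^sup>+\<omega>. D * (ennreal (exp (36 * ?A \<omega>)) + ennreal (exp (c * ?B \<omega>))) \<partial>M)"
    proof (rule nn_integral_mono_AE)
      show "AE \<omega> in M. ennreal (exp (6 * (LBINT u:{s..t}. (real_of_ereal (Y u \<omega>) * before \<zeta> u \<omega>)\<^sup>2)))
          \<le> D * (ennreal (exp (36 * ?A \<omega>)) + ennreal (exp (c * ?B \<omega>)))"
        using bound AE_space
      proof eventually_elim
        case (elim \<omega>)
        have Ic: "continuous_on {0..} (\<lambda>u. I u \<omega>)"
          using I' elim(2) by (auto simp: continuous_paths_def)
        let ?H = "\<lambda>u. real_of_ereal (Y u \<omega>) * before \<zeta> u \<omega>" and ?m = "LBINT v:{0..T}. \<bar>I v \<omega>\<bar>"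
        have A_int: "set_integrable lborel {s..t} (\<lambda>u. (I u \<omega>)\<^sup>2)"
          using st by (intro borel_integrable_atLeastAtMost' continuous_intros continuous_on_subset[OF Ic]) auto
        have m: "?m\<^sup>2 \<le> T * ?B \<omega>"
          using \<open>0 < T\<close> by (intro set_integral_cauchy_schwarz continuous_on_subset[OF Ic]) auto
        have H: "(?H u)\<^sup>2 \<le> (3 * C\<^sup>2 + 3 * (\<kappa>\<^sup>2 * (T * ?B \<omega>))) + 3 * (I u \<omega>)\<^sup>2" if "u \<in> {s..t}" for u
        proof -
          have "\<bar>?H u\<bar> \<le> C + \<kappa> * ?m + \<bar>I u \<omega>\<bar>"
            using elim(1) that st by (auto simp: C_def)
          then have "(?H u)\<^sup>2 \<le> (C + \<kappa> * ?m + \<bar>I u \<omega>\<bar>)\<^sup>2"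
            by (metis abs_ge_zero order_trans power2_abs power_mono)
          also have "\<dots> \<le> 3 * C\<^sup>2 + 3 * (\<kappa> * ?m)\<^sup>2 + 3 * \<bar>I u \<omega>\<bar>\<^sup>2"
          proof -
            have "(a + b + d)\<^sup>2 \<le> 3 * a\<^sup>2 + 3 * b\<^sup>2 + 3 * d\<^sup>2" for a b d :: real
              using sum_squares_ge_zero[of "a - b" "a - d"] zero_le_square[of "b - d"]
              by (simp add: power2_eq_square algebra_simps)
            then show ?thesis .
          qed
          also have "(\<kappa> * ?m)\<^sup>2 \<le> \<kappa>\<^sup>2 * (T * ?B \<omega>)"
            unfolding power_mult_distrib by (intro mult_left_mono m) simp
          finally show ?thesis by simp
        qed
        define k where "k = 3 * C\<^sup>2 + 3 * (\<kappa>\<^sup>2 * (T * ?B \<omega>))"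
        have B: "0 \<le> ?B \<omega>"
          unfolding set_lebesgue_integral_def by (intro Bochner_Integration.integral_nonneg) simp
        have k: "0 \<le> k" using B \<open>0 < T\<close> by (simp add: k_def)
        have kI: "set_integrable lborel {s..t} (\<lambda>u. k)"
          by (intro borel_integrable_atLeastAtMost' continuous_intros)
        have "(LBINT u:{s..t}. (?H u)\<^sup>2) \<le> (LBINT u:{s..t}. k + 3 * (I u \<omega>)\<^sup>2)"
          unfolding set_lebesgue_integral_def
        proof (rule integral_mono')
          show "integrable lborel (\<lambda>u. indicator {s..t} u *\<^sub>R (k + 3 * (I u \<omega>)\<^sup>2))"
            using set_integral_add(1)[OF kI set_integrable_mult_right[OF A_int, of 3]]
            by (simp add: set_integrable_def)
          show "indicator {s..t} u *\<^sub>R (?H u)\<^sup>2 \<le> indicator {s..t} u *\<^sub>R (k + 3 * (I u \<omega>)\<^sup>2)" for u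
            using H[of u] by (simp add: k_def split: split_indicator)
          show "0 \<le> indicator {s..t} u *\<^sub>R (k + 3 * (I u \<omega>)\<^sup>2)" for u
            using k by (simp split: split_indicator)
        qed
        also have "\<dots> = k * (t - s) + 3 * ?A \<omega>"
          using kI A_int st by (subst set_integral_add(2)) (auto simp: set_lebesgue_integral_def[of lborel "{s..t}" "\<lambda>_. _"])
        also have "k * (t - s) \<le> 3 * C\<^sup>2 * T + 3 * (\<kappa>\<^sup>2 * (T * ?B \<omega>)) * \<delta>"
          unfolding k_def distrib_right using st B \<open>0 < T\<close> by (intro add_mono mult_left_mono) auto
        finally have "6 * (LBINT u:{s..t}. (?H u)\<^sup>2) \<le> 18 * C\<^sup>2 * T + (18 * ?A \<omega> + c / 2 * ?B \<omega>)"
          by (simp add: c_def algebra_simps)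
        then have "exp (6 * (LBINT u:{s..t}. (?H u)\<^sup>2)) \<le> exp (18 * C\<^sup>2 * T) * exp (18 * ?A \<omega> + c / 2 * ?B \<omega>)"
          unfolding exp_add[symmetric] by simp
        also have "exp (18 * ?A \<omega> + c / 2 * ?B \<omega>) \<le> exp (36 * ?A \<omega>) + exp (c * ?B \<omega>)"
        proof -
          define a b where "a = exp (18 * ?A \<omega>)" and "b = exp (c / 2 * ?B \<omega>)"
          have "a\<^sup>2 = exp (36 * ?A \<omega>)" "b\<^sup>2 = exp (c * ?B \<omega>)"
            unfolding a_def b_def by (simp_all add: exp_double[symmetric])
          moreover have "2 * (a * b) \<le> a\<^sup>2 + b\<^sup>2" "0 \<le> a * b"
            using sum_squares_bound[of a b] by (simp_all add: a_def b_def)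
          moreover have "exp (18 * ?A \<omega> + c / 2 * ?B \<omega>) = a * b"
            by (simp add: a_def b_def exp_add)
          ultimately show ?thesis by linarith
        qed
        finally have "exp (6 * (LBINT u:{s..t}. (?H u)\<^sup>2))
            \<le> exp (18 * C\<^sup>2 * T) * (exp (36 * ?A \<omega>) + exp (c * ?B \<omega>))" by simp
        then show ?case
          unfolding D_def by (simp add: ennreal_mult'[symmetric] ennreal_plus[symmetric] ennreal_leI del: ennreal_plus)
      qed
    qed
    also have "\<dots> = D * ((\<integral>\<^sup>+\<omega>. ennreal (exp (36 * ?A \<omega>)) \<partial>M) + (\<integral>\<^sup>+\<omega>. ennreal (exp (c * ?B \<omega>)) \<partial>M))"
    proof -
      note m = continuous_adapted_measurable[OF F I']
      have [measurable]: "(\<lambda>\<omega>. LBINT u:{a..b}. (I u \<omega>)\<^sup>2) \<in> borel_measurable M" if "0 \<le> a" for a b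
      proof -
        have "(\<lambda>(\<omega>, u). indicator {a..b} u *\<^sub>R (I (max 0 u) \<omega>)\<^sup>2) \<in> borel_measurable (M \<Otimes>\<^sub>M lborel)"
          using m unfolding case_prod_beta by measurable
        from lborel.borel_measurable_lebesgue_integral[OF this]
        have "(\<lambda>\<omega>. \<integral>u. indicator {a..b} u *\<^sub>R (I (max 0 u) \<omega>)\<^sup>2 \<partial>lborel) \<in> borel_measurable M" .
        moreover have eq: "indicator {a..b} u *\<^sub>R (I (max 0 u) \<omega>)\<^sup>2 = indicator {a..b} u *\<^sub>R (I u \<omega>)\<^sup>2" for u \<omega>
          using that by (simp add: max_def split: split_indicator)
        ultimately show ?thesis
          unfolding set_lebesgue_integral_def eq by blast
      qed
      have [measurable]: "?A \<in> borel_measurable M" "?B \<in> borel_measurable M"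
        using st by simp_all
      show ?thesis
        by (simp add: nn_integral_cmult nn_integral_add)
    qed
    also have "\<dots> \<le> D * (ennreal (sqrt 2) + ennreal (sqrt 2))"
      by (intro mult_left_mono add_mono EA EB) simp
    also have "\<dots> < \<infinity>"
      by (simp add: D_def ennreal_mult_less_top)
    finally show ?thesis .
  qed
  show thesis
    by (rule that[OF \<open>0 < \<delta>\<close> main])
qed

section \<open>The martingale property\<close>

text \<open>A general nonnegative weight \<open>Z\<close> in place of an event is what allows
  chaining: it absorbs \<open>S s\<close>, and it stays measurable at every later starting
  time.\<close>

lemma stochastic_exponential_increment:
  assumes F: "filtered_prob_space M F" and B: "brownian_motion M F B" and X: "ito_integral M F B H X"
    and S: "adapted F S"
    and S_eq: "AE \<omega> in M. \<forall>t\<ge>0. S t \<omega> = exp (X t \<omega> - 1/2 * (LBINT u:{0..t}. (H u \<omega>)\<^sup>2))"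
    and st: "0 \<le> s" "s \<le> t"
    and fin: "(\<integral>\<^sup>+\<omega>. ennreal (exp (6 * (LBINT u:{s..t}. (H u \<omega>)\<^sup>2))) \<partial>M) < \<infinity>"
    and Z: "Z \<in> borel_measurable (F s)"
  shows "(\<integral>\<^sup>+\<omega>. Z \<omega> * ennreal (S t \<omega>) \<partial>M) = (\<integral>\<^sup>+\<omega>. Z \<omega> * ennreal (S s \<omega>) \<partial>M)"
proof -
  have H: "progressively_measurable F H" and X': "adapted F X"
    and H2: "AE \<omega> in M. \<forall>T\<ge>0. (\<integral>\<^sup>+ u\<in>{0..T}. ennreal ((H u \<omega>)\<^sup>2) \<partial>lborel) < \<infinity>"
    using X unfolding ito_integral_def by blast+
  let ?V = "\<lambda>s t \<omega>. LBINT u:{s..t}. (H u \<omega>)\<^sup>2"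
  define R where "R \<omega> = ennreal (exp (X t \<omega> - X s \<omega> - ?V s t \<omega> / 2))" for \<omega>
  have "X u \<in> borel_measurable M" if "0 \<le> u" for u
    using X' that by (intro filtered_measurable_M[OF F, of "X u" u]) (simp add: adapted_def)
  then have "X t \<in> borel_measurable M" "X s \<in> borel_measurable M"
    using st by simp_all
  then have R[measurable]: "R \<in> borel_measurable M"
    using ito_variation_measurable[OF F H st] unfolding R_def[abs_def] by measurable
  have id: "(\<lambda>\<omega>. \<omega>) \<in> measurable M (F s)" and sets: "sets (F s) \<subseteq> sets M" and space: "space (F s) = space M"
    using filtered_prob_space_subalgebra[OF F, of s] by (auto simp: subalgebra_def measurable_def)
  \<comment> \<open>The identity on events says that \<open>density M R\<close> and \<open>M\<close>
    agree on \<open>F s\<close>; hence so do the integrals of all nonnegative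
    \<open>F s\<close>-measurable functions, without integrability of products.\<close>
  have distr: "distr (density M R) (F s) (\<lambda>\<omega>. \<omega>) = distr M (F s) (\<lambda>\<omega>. \<omega>)"
  proof (rule measure_eqI)
    fix A assume "A \<in> sets (distr (density M R) (F s) (\<lambda>\<omega>. \<omega>))"
    then have A: "A \<in> sets (F s)" by simp
    then have A': "A \<in> sets M" and "(\<lambda>\<omega>. \<omega>) -` A \<inter> space M = A"
      using sets sets.sets_into_space[OF A] space by auto
    moreover have "emeasure (density M R) A = emeasure M A"
    proof -
      have "emeasure (density M R) A = (\<integral>\<^sup>+\<omega>. indicator A \<omega> * R \<omega> \<partial>M)"
        using A' by (simp add: emeasure_density mult.commute)
      also have "\<dots> = emeasure M A"
        using ito_integral_exponential[OF F B X st A, of 1] fin by (simp add: R_def)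
      finally show ?thesis .
    qed
    ultimately show "emeasure (distr (density M R) (F s) (\<lambda>\<omega>. \<omega>)) A = emeasure (distr M (F s) (\<lambda>\<omega>. \<omega>)) A"
      using A id by (simp add: emeasure_distr)
  qed simp
  have R_integral: "(\<integral>\<^sup>+\<omega>. f \<omega> * R \<omega> \<partial>M) = (\<integral>\<^sup>+\<omega>. f \<omega> \<partial>M)" if f: "f \<in> borel_measurable (F s)" for f
  proof -
    have f': "f \<in> borel_measurable M" by (rule filtered_measurable_M[OF F f])
    have "(\<integral>\<^sup>+\<omega>. f \<omega> * R \<omega> \<partial>M) = (\<integral>\<^sup>+\<omega>. f \<omega> \<partial>density M R)"
      using f' by (simp add: nn_integral_density mult.commute)
    also have "\<dots> = (\<integral>\<^sup>+\<omega>. f \<omega> \<partial>distr (density M R) (F s) (\<lambda>\<omega>. \<omega>))"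
      using f id by (subst nn_integral_distr) simp_all
    also have "\<dots> = (\<integral>\<^sup>+\<omega>. f \<omega> \<partial>M)"
      unfolding distr using f id by (subst nn_integral_distr) simp_all
    finally show ?thesis .
  qed
  have "(\<integral>\<^sup>+\<omega>. Z \<omega> * ennreal (S t \<omega>) \<partial>M) = (\<integral>\<^sup>+\<omega>. (Z \<omega> * ennreal (S s \<omega>)) * R \<omega> \<partial>M)"
  proof (rule nn_integral_cong_AE)
    show "AE \<omega> in M. Z \<omega> * ennreal (S t \<omega>) = (Z \<omega> * ennreal (S s \<omega>)) * R \<omega>"
      using S_eq H2 AE_space
    proof eventually_elim
      case (elim \<omega>)
      have fin: "(\<integral>\<^sup>+ u\<in>{0..t}. ennreal ((H u \<omega>)\<^sup>2) \<partial>lborel) < \<infinity>" using elim(2) st by simp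
      have V: "?V 0 t \<omega> = ?V 0 s \<omega> + ?V s t \<omega>"
      proof -
        have "?V 0 t \<omega> = (LBINT u:{0..s} \<union> {s..t}. (H u \<omega>)\<^sup>2)"
          using st by (simp add: ivl_disj_un_two_touch)
        also have "\<dots> = ?V 0 s \<omega> + ?V s t \<omega>"
        proof (rule set_integral_Un_AE)
          show "AE u in lborel. \<not> (u \<in> {0..s} \<and> u \<in> {s..t})"
            using AE_lborel_singleton[of s] by eventually_elim auto
        qed (use st in \<open>auto intro: ito_integrand_square_integrable(2)[OF F H elim(3) fin]\<close>)
        finally show ?thesis .
      qed
      have "S t \<omega> = S s \<omega> * exp (X t \<omega> - X s \<omega> - ?V s t \<omega> / 2)"
      proof -
        have "S t \<omega> = exp (X t \<omega> - 1/2 * ?V 0 t \<omega>)" "S s \<omega> = exp (X s \<omega> - 1/2 * ?V 0 s \<omega>)"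
          using elim(1) st by auto
        then show ?thesis by (simp add: V mult_exp_exp field_simps)
      qed
      then show ?case by (simp add: R_def ennreal_mult'' mult.assoc)
    qed
  qed
  also have "\<dots> = (\<integral>\<^sup>+\<omega>. Z \<omega> * ennreal (S s \<omega>) \<partial>M)"
  proof (rule R_integral)
    have "S s \<in> borel_measurable (F s)" using S st by (simp add: adapted_def)
    then show "(\<lambda>\<omega>. Z \<omega> * ennreal (S s \<omega>)) \<in> borel_measurable (F s)"
      using Z by measurable
  qed
  finally show ?thesis .
qed

text \<open>Novikov's condition localised in time: the ratios over successive short windows each
  have conditional expectation 1. The window length may shrink with the horizon but not with the
  position, so finitely many windows reach from \<open>s\<close> to \<open>t\<close>.\<close>

lemma stochastic_exponential_martingale:
  assumes F: "filtered_prob_space M F" and B: "brownian_motion M F B" and X: "ito_integral M F B H X"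
    and S: "adapted F S"
    and S_eq: "AE \<omega> in M. \<forall>t\<ge>0. S t \<omega> = exp (X t \<omega> - 1/2 * (LBINT u:{0..t}. (H u \<omega>)\<^sup>2))"
    and fin: "\<And>T. 0 < T \<Longrightarrow> \<exists>\<delta>>0. \<forall>s t. 0 \<le> s \<longrightarrow> s \<le> t \<longrightarrow> t \<le> T \<longrightarrow> t - s \<le> \<delta> \<longrightarrow>
      (\<integral>\<^sup>+\<omega>. ennreal (exp (6 * (LBINT u:{s..t}. (H u \<omega>)\<^sup>2))) \<partial>M) < \<infinity>"
  shows "martingale M F S"
proof -
  interpret prob_space M by (rule filtered_prob_space_prob_space[OF F])
  have step: "(\<integral>\<^sup>+\<omega>. Z \<omega> * ennreal (S t \<omega>) \<partial>M) = (\<integral>\<^sup>+\<omega>. Z \<omega> * ennreal (S s \<omega>) \<partial>M)"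
    if st: "0 \<le> s" "s \<le> t" and Z: "Z \<in> borel_measurable (F s)" for s t Z
  proof -
    \<comment> \<open>The horizon is \<open>t + 1\<close> because \<open>fin\<close> asks for a
      positive one and \<open>t\<close> may be 0.\<close>
    obtain \<delta> where "0 < \<delta>" and \<delta>: "\<And>r u. 0 \<le> r \<Longrightarrow> r \<le> u \<Longrightarrow> u \<le> t + 1 \<Longrightarrow> u - r \<le> \<delta> \<Longrightarrow>
        (\<integral>\<^sup>+\<omega>. ennreal (exp (6 * (LBINT v:{r..u}. (H v \<omega>)\<^sup>2))) \<partial>M) < \<infinity>"
      using fin[of "t + 1"] st by auto
    have chain: "s \<le> u \<Longrightarrow> u \<le> t \<Longrightarrow> u - s \<le> real n * \<delta> \<Longrightarrow>
        (\<integral>\<^sup>+\<omega>. Z \<omega> * ennreal (S u \<omega>) \<partial>M) = (\<integral>\<^sup>+\<omega>. Z \<omega> * ennreal (S s \<omega>) \<partial>M)" for n u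
    proof (induction n arbitrary: u)
      case (Suc n)
      \<comment> \<open>One window back from \<open>u\<close>, but not beyond \<open>s\<close>; the
        remaining distance needs only \<open>n\<close> windows.\<close>
      define r where "r = max s (u - \<delta>)"
      have r: "0 \<le> r" "s \<le> r" "r \<le> u" "r \<le> t" "u - r \<le> \<delta>" "r - s \<le> real n * \<delta>"
        using Suc.prems st \<open>0 < \<delta>\<close> by (auto simp: r_def max_def algebra_simps)
      have "Z \<in> borel_measurable (F r)" by (rule filtered_measurable_mono[OF F r(2) Z])
      then have "(\<integral>\<^sup>+\<omega>. Z \<omega> * ennreal (S u \<omega>) \<partial>M) = (\<integral>\<^sup>+\<omega>. Z \<omega> * ennreal (S r \<omega>) \<partial>M)"
        using r Suc.prems by (intro stochastic_exponential_increment[OF F B X S S_eq r(1,3)] \<delta>) auto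
      with Suc.IH[OF r(2,4,6)] show ?case by simp
    qed simp
    obtain n where "(t - s) / \<delta> \<le> real n" using real_arch_simple by blast
    then have "t - s \<le> real n * \<delta>" using \<open>0 < \<delta>\<close> by (simp add: pos_divide_le_eq)
    then show ?thesis using st by (intro chain) auto
  qed
  have S_meas[measurable]: "S t \<in> borel_measurable M" if "0 \<le> t" for t
    using S that by (intro filtered_measurable_M[OF F, of "S t" t]) (simp add: adapted_def)
  have S_nonneg: "AE \<omega> in M. 0 \<le> S t \<omega>" if "0 \<le> t" for t
    using S_eq by eventually_elim (use that in simp)
  have S_0: "AE \<omega> in M. S 0 \<omega> = 1"
    using S_eq ito_integral_at_0[OF F B X]
  proof eventually_elim
    case (elim \<omega>)
    have "(LBINT u:{0..0}. (H u \<omega>)\<^sup>2) = 0"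
      unfolding set_lebesgue_integral_def
      by (rule integral_eq_zero_AE) (use AE_lborel_singleton[of 0] in eventually_elim, simp)
    then show ?case using elim by simp
  qed
  \<comment> \<open>Integrability of \<open>S t\<close> is a consequence of the identity for
    nonnegative integrals, taken from time 0 with weight 1.\<close>
  have S_1: "(\<integral>\<^sup>+\<omega>. ennreal (S t \<omega>) \<partial>M) = 1" if "0 \<le> t" for t
  proof -
    have "(\<integral>\<^sup>+\<omega>. ennreal (S t \<omega>) \<partial>M) = (\<integral>\<^sup>+\<omega>. ennreal (S 0 \<omega>) \<partial>M)"
      using step[OF order_refl that, of "\<lambda>_. 1"] by simp
    also have "\<dots> = (\<integral>\<^sup>+\<omega>. 1 \<partial>M)"
    proof (rule nn_integral_cong_AE)
      show "AE \<omega> in M. ennreal (S 0 \<omega>) = 1"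
        using S_0 by eventually_elim simp
    qed
    finally show ?thesis by (simp add: emeasure_space_1)
  qed
  have S_int: "integrable M (S t)" if "0 \<le> t" for t
    using S_1[OF that] S_nonneg[OF that] that by (intro integrableI_nonneg) auto
  have "AE \<omega> in M. real_cond_exp M (F s) (S t) \<omega> = S s \<omega>" if st: "0 \<le> s" "s \<le> t" for s t
  proof -
    interpret finite_measure_subalgebra M "F s"
      by unfold_locales (rule filtered_prob_space_subalgebra[OF F])
    have "0 \<le> t" using st by simp
    show ?thesis
    proof (rule real_cond_exp_charact)
      fix A assume A: "A \<in> sets (F s)"
      then have A'[measurable]: "A \<in> sets M"
        using filtered_prob_space_subalgebra[OF F, of s] by (auto simp: subalgebra_def)
      have eq: "(\<integral>\<omega>\<in>A. S r \<omega> \<partial>M) = enn2real (\<integral>\<^sup>+\<omega>. indicator A \<omega> * ennreal (S r \<omega>) \<partial>M)" if "0 \<le> r" for r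
      proof -
        have "(\<integral>\<omega>\<in>A. S r \<omega> \<partial>M) = enn2real (\<integral>\<^sup>+\<omega>. ennreal (indicator A \<omega> *\<^sub>R S r \<omega>) \<partial>M)"
          unfolding set_lebesgue_integral_def
        proof (rule integral_eq_nn_integral)
          show "(\<lambda>\<omega>. indicator A \<omega> *\<^sub>R S r \<omega>) \<in> borel_measurable M"
            using S_meas[OF that] by measurable
          show "AE \<omega> in M. 0 \<le> indicator A \<omega> *\<^sub>R S r \<omega>"
            using S_nonneg[OF that] by eventually_elim simp
        qed
        also have "(\<integral>\<^sup>+\<omega>. ennreal (indicator A \<omega> *\<^sub>R S r \<omega>) \<partial>M) = (\<integral>\<^sup>+\<omega>. indicator A \<omega> * ennreal (S r \<omega>) \<partial>M)"
          by (intro nn_integral_cong) (simp split: split_indicator)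
        finally show ?thesis .
      qed
      show "(\<integral>\<omega>\<in>A. S t \<omega> \<partial>M) = (\<integral>\<omega>\<in>A. S s \<omega> \<partial>M)"
        using step[OF st borel_measurable_indicator[OF A]] eq[OF \<open>0 \<le> t\<close>] eq[OF st(1)] by simp
    next
      show "S s \<in> borel_measurable (F s)" using S st by (simp add: adapted_def)
    qed (use S_int \<open>0 \<le> t\<close> st in auto)
  qed
  then show ?thesis
    using S S_int by (simp add: martingale_def)
qed

theorem proposition5p7:
  fixes M :: "'a measure" and F :: "real \<Rightarrow> 'a measure"
    and W W1 W2 S :: "real \<Rightarrow> 'a \<Rightarrow> real" and Y :: "real \<Rightarrow> 'a \<Rightarrow> ereal" and \<zeta> :: "'a \<Rightarrow> ereal"
    and \<kappa> \<theta> \<gamma> \<rho> x\<^sub>0 :: real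
  assumes "\<kappa> > 0" and "\<theta> > 0" and "\<gamma> > 0" and "-1 \<le> \<rho>" and "\<rho> \<le> 1"
    and "filtered_prob_space M F"
    and "brownian_motion M F W" and "brownian_motion M F W1"
    and "brownian_motion M (\<lambda>t. generated_sigma M {0..t} W2) W2"
    and "AE \<omega> in M. \<forall>t\<ge>0. W1 t \<omega> = \<rho> * W t \<omega> + sqrt (1 - \<rho>\<^sup>2) * W2 t \<omega>"
    and "prob_space.indep_set M (sets (generated_sigma M {0..} W2))
           (sets (generated_sigma M {0..} (\<lambda>t \<omega>. (Y t \<omega>, W t \<omega>))))"
    and "sz_variance M F W \<kappa> \<theta> \<gamma> x\<^sub>0 Y \<zeta>"
    and "sz_stock_price M F W1 Y \<zeta> S"
  shows "martingale M F S"
proof -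
  note F = assms(6) and sz = assms(12) and price = assms(13)
  have S: "adapted F S"
    using price unfolding sz_stock_price_def by blast
  from price obtain X where X: "ito_integral M F W1 (\<lambda>t \<omega>. real_of_ereal (Y t \<omega>) * before \<zeta> t \<omega>) X"
    and S_eq: "AE \<omega> in M. \<forall>t\<ge>0. S t \<omega> =
           exp (X t \<omega> - 1/2 * (LBINT u:{0..t}. (real_of_ereal (Y u \<omega>) * before \<zeta> u \<omega>)\<^sup>2))"
    unfolding sz_stock_price_def by blast
  show ?thesis
  \<comment> \<open>The exponential is driven by \<open>W1\<close>, whereas the moment condition to
    be checked is an estimate on \<open>Y\<close>, driven by \<open>W\<close>.\<close>
  proof (rule stochastic_exponential_martingale[OF F assms(8) X S S_eq])
    fix T :: real assume "0 < T"
    show "\<exists>\<delta>>0. \<forall>s t. 0 \<le> s \<longrightarrow> s \<le> t \<longrightarrow> t \<le> T \<longrightarrow> t - s \<le> \<delta> \<longrightarrow>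
      (\<integral>\<^sup>+\<omega>. ennreal (exp (6 * (LBINT u:{s..t}. (real_of_ereal (Y u \<omega>) * before \<zeta> u \<omega>)\<^sup>2))) \<partial>M) < \<infinity>"
      by (rule sz_exp_variation_finite[OF F assms(7) sz assms(1-3) \<open>0 < T\<close>]) blast
  qed
qed

end
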